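(* Let $N$ be a (positive) constant multiple of the Frobenius norm on $3\times3$ matrices and let $f\colon \mathbb{T}\to\mathbb{C}$ be a bounded function such that: (f1) $f(z)=0$ if and only if $z=1$; (f2) $f$ is conformal in a neighbourhood of $1$; (f3) $f$ is continuous on $\mathbb{T}\setminus\{-1\}$; (f4) $f(-1)=\lim_{t\uparrow\pi}f(e^{\mathrm{i}t})$; (f5) the limit $\lim_{t\downarrow-\pi}f(e^{\mathrm{i}t})$ is different from $0$. For $A,B\in SO(3)$ put $d_{N,f}(A,B)=N(f(A^{-1}B))$. Then a map $\phi\colon SO(3)\to SO(3)$ satisfies $$d_{N,f}(\phi(A),\phi(B))=d_{N,f}(A,B)\qquad\text{for all } A,B\in SO(3)$$ if and only if there exists an orthogonal matrix $Q\in O(3)$ such that $\phi$ is of one of the following forms: (a) $\phi(A)=\phi(I)QAQ^{-1}$ for all $A\in SO(3)$; (b) $\phi(A)=\phi(I)QA^{-1}Q^{-1}$ for all $A\in SO(3)$.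
   Context: $\mathbb{T}$ is the unit circle in $\mathbb{C}$. $O(3)$ and $SO(3)$ are the groups of real orthogonal $3\times3$ matrices and of those with determinant $1$; $I$ is the identity matrix. For $A\in SO(3)$, which is a normal matrix with spectrum in $\mathbb{T}$, $f(A)$ is defined by the usual Borel function calculus: if $A=U\,\mathrm{diag}(z_1,z_2,z_3)U^{*}$ with $U$ unitary, then $f(A)=U\,\mathrm{diag}(f(z_1),f(z_2),f(z_3))U^{*}$. "Conformal in a neighbourhood of $1$" means that near $1$ the function $f$ is given by a convergent power series in $z-1$ with nonzero first-order coefficient; since $f(1)=0$, this reads $f(z)=\sum_{k\ge1}a_k(z-1)^k$ with $a_1\neq0$, for $z\in\mathbb{T}$ near $1$. *)

theory Defs
  imports "HOL-Analysis.Analysis"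
begin

definition O3 :: "(real^3^3) set" where
  "O3 = {Q. orthogonal_matrix Q}"

definition SO3 :: "(real^3^3) set" where
  "SO3 = {A. orthogonal_matrix A \<and> det A = 1}"

definition ctranspose :: "complex^'n^'m \<Rightarrow> complex^'m^'n" where
  "ctranspose M = map_matrix cnj (transpose M)"

definition unitary_matrix :: "complex^'n^'n \<Rightarrow> bool" where
  "unitary_matrix U \<longleftrightarrow> ctranspose U ** U = mat 1 \<and> U ** ctranspose U = mat 1"

definition diag_matrix :: "complex^'n \<Rightarrow> complex^'n^'n" where
  "diag_matrix z = (\<chi> i j. if i = j then z $ i else 0)"

text \<open>
  The functional calculus for normal matrices.  The result depends neither on the unitary
  matrix nor on the order of the eigenvalues (lemma \<open>matrix_fun_unitary_diag\<close> below), and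
  only the values of \<open>f\<close> on the spectrum matter.  The value is unspecified if the matrix is
  not unitarily diagonalizable.
\<close>

definition matrix_fun :: "(complex \<Rightarrow> complex) \<Rightarrow> complex^'n^'n \<Rightarrow> complex^'n^'n" where
  "matrix_fun f A = (THE M. \<exists>U z. unitary_matrix U \<and>
      A = U ** diag_matrix z ** ctranspose U \<and>
      M = U ** diag_matrix (\<chi> i. f (z $ i)) ** ctranspose U)"

lemma diag_matrix_mult_right: "(M ** diag_matrix z) $ i $ j = M $ i $ j * z $ j"
  by (simp add: matrix_matrix_mult_def diag_matrix_def if_distrib[of "\<lambda>x. _ * x"] cong: if_cong)

lemma diag_matrix_mult_left: "(diag_matrix z ** M) $ i $ j = z $ i * M $ i $ j"
  by (simp add: matrix_matrix_mult_def diag_matrix_def if_distrib[of "\<lambda>x. x * _"] cong: if_cong)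

lemma matrix_fun_unique:
  assumes U: "unitary_matrix U" and V: "unitary_matrix V"
    and eq: "U ** diag_matrix z ** ctranspose U = V ** diag_matrix w ** ctranspose V"
  shows "U ** diag_matrix (\<chi> i. f (z $ i)) ** ctranspose U =
         V ** diag_matrix (\<chi> i. f (w $ i)) ** ctranspose V"
proof -
  define W where "W = ctranspose V ** U"
  have "ctranspose V ** (U ** diag_matrix z ** ctranspose U) ** U = W ** diag_matrix z"
    using U by (simp add: W_def unitary_matrix_def matrix_mul_assoc[symmetric])
  moreover have "ctranspose V ** (V ** diag_matrix w ** ctranspose V) ** U = diag_matrix w ** W"
    using V by (simp add: W_def unitary_matrix_def matrix_mul_assoc)
  ultimately have *: "W ** diag_matrix z = diag_matrix w ** W"
    using eq by simp
  have "W ** diag_matrix (\<chi> i. f (z $ i)) = diag_matrix (\<chi> i. f (w $ i)) ** W"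
  proof -
    have "W $ i $ j * f (z $ j) = f (w $ i) * W $ i $ j" for i j
    proof -
      have "W $ i $ j * z $ j = w $ i * W $ i $ j"
        using * by (metis diag_matrix_mult_left diag_matrix_mult_right)
      then show ?thesis by (cases "W $ i $ j = 0") auto
    qed
    then show ?thesis
      by (simp add: vec_eq_iff diag_matrix_mult_left diag_matrix_mult_right)
  qed
  then have "V ** (W ** diag_matrix (\<chi> i. f (z $ i))) ** ctranspose U =
             V ** (diag_matrix (\<chi> i. f (w $ i)) ** W) ** ctranspose U"
    by simp
  moreover have "V ** (W ** diag_matrix (\<chi> i. f (z $ i))) ** ctranspose U =
                 U ** diag_matrix (\<chi> i. f (z $ i)) ** ctranspose U"
    using V by (simp add: W_def unitary_matrix_def matrix_mul_assoc)
  moreover have "V ** (diag_matrix (\<chi> i. f (w $ i)) ** W) ** ctranspose U =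
                 V ** diag_matrix (\<chi> i. f (w $ i)) ** ctranspose V"
    using U by (simp add: W_def unitary_matrix_def matrix_mul_assoc[symmetric])
  ultimately show ?thesis by simp
qed

lemma matrix_fun_unitary_diag:
  assumes "unitary_matrix U"
  shows "matrix_fun f (U ** diag_matrix z ** ctranspose U) =
         U ** diag_matrix (\<chi> i. f (z $ i)) ** ctranspose U"
  unfolding matrix_fun_def
proof (rule the_equality)
  show "\<exists>U' w. unitary_matrix U' \<and>
      U ** diag_matrix z ** ctranspose U = U' ** diag_matrix w ** ctranspose U' \<and>
      U ** diag_matrix (\<chi> i. f (z $ i)) ** ctranspose U =
      U' ** diag_matrix (\<chi> i. f (w $ i)) ** ctranspose U'"
    using assms by (intro exI[of _ U] exI[of _ z]) simp
qed (metis assms matrix_fun_unique)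

definition frobenius_norm :: "complex^'n^'m \<Rightarrow> real" where
  "frobenius_norm M = sqrt (\<Sum>i\<in>UNIV. \<Sum>j\<in>UNIV. (cmod (M $ i $ j))\<^sup>2)"

lemma frobenius_norm_eq_norm: "frobenius_norm M = norm M"
  unfolding frobenius_norm_def norm_vec_def L2_set_def
  by (simp add: real_sqrt_pow2 sum_nonneg)

text \<open>
  Conformality at \<open>1\<close> of a function on the unit circle: near \<open>1\<close> it is given by a power
  series in \<open>z - 1\<close> with nonzero first-order coefficient.
\<close>

definition conformal_near_1 :: "(complex \<Rightarrow> complex) \<Rightarrow> bool" where
  "conformal_near_1 f \<longleftrightarrow> (\<exists>a r. r > 0 \<and> a 1 \<noteq> 0 \<and>
      (\<forall>z\<in>sphere 0 1. dist z 1 < r \<longrightarrow> (\<lambda>k::nat. a k * (z - 1) ^ k) sums f z))"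

text \<open>The real matrix \<open>A\<inverse> B\<close> is regarded as a complex matrix before \<open>f\<close> is applied.\<close>

definition dist_Nf ::
    "(complex^3^3 \<Rightarrow> real) \<Rightarrow> (complex \<Rightarrow> complex) \<Rightarrow> real^3^3 \<Rightarrow> real^3^3 \<Rightarrow> real" where
  "dist_Nf N f A B = N (matrix_fun f (map_matrix complex_of_real (matrix_inv A ** B)))"

end

theory Submission
  imports Defs
begin

text \<open>
  If \<open>A\<inverse> B\<close> is a rotation by \<open>\<theta>\<close>, its eigenvalues are \<open>1\<close> and \<open>exp (\<plusminus> \<i> \<theta>)\<close>, so the distance of
  \<open>A\<close> and \<open>B\<close> depends only on \<open>\<theta>\<close>, through \<open>|f (exp (\<i> \<theta>))|\<^sup>2 + |f (exp (- \<i> \<theta>))|\<^sup>2\<close>.  Conformality at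
  \<open>1\<close> makes this strictly increasing for small \<open>\<theta>\<close>, and the other conditions bound it away from \<open>0\<close>
  elsewhere; hence \<open>\<phi>\<close> preserves all small angles, that is (as \<open>A \<bullet> B = 1 + 2 cos \<theta>\<close>) the Frobenius
  inner products of nearby rotations.  Equality of Gram matrices makes \<open>\<phi>\<close> linear on small balls of
  \<open>SO3\<close>.  These balls span the whole matrix space, so the linear maps agree on overlaps, and by
  connectedness \<open>\<phi>\<close> is the restriction of one linear isometry \<open>T\<close>, with \<open>T I = I\<close> after normalization.
  Traces are preserved, so half turns and quarter turns are mapped to such; this yields an orthogonal
  \<open>Q\<close> with \<open>T (v v\<^sup>t) = Q v (Q v)\<^sup>t\<close> that maps the cross product matrix of \<open>v\<close> to that of \<open>Q v\<close>.
  The two forms of \<open>\<phi>\<close> correspond to the sign of \<open>det Q\<close>.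
\<close>

section \<open>Rotations of three-space\<close>

lemma matrix_inv_orthogonal:
  fixes Q :: "real^'n^'n"
  assumes "orthogonal_matrix Q"
  shows "matrix_inv Q = transpose Q"
proof -
  have Q: "Q ** transpose Q = mat 1" "transpose Q ** Q = mat 1"
    using assms by (simp_all add: orthogonal_matrix_def)
  have "invertible Q"
    using Q by (auto simp: invertible_def)
  then have "Q ** matrix_inv Q = mat 1"
    unfolding invertible_def matrix_inv_def by (rule someI_ex[THEN conjunct1])
  then have "transpose Q ** (Q ** matrix_inv Q) = transpose Q" by simp
  then show ?thesis by (simp add: matrix_mul_assoc Q)
qed

lemma inner_matrix_eq_trace:
  fixes A B :: "real^'n^'m"
  shows "A \<bullet> B = trace (transpose A ** B)"
proof -
  have "A \<bullet> B = (\<Sum>i\<in>UNIV. \<Sum>j\<in>UNIV. A $ i $ j * B $ i $ j)"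
    by (simp add: inner_vec_def)
  also have "\<dots> = (\<Sum>j\<in>UNIV. \<Sum>i\<in>UNIV. A $ i $ j * B $ i $ j)"
    by (rule sum.swap)
  finally show ?thesis
    by (simp add: trace_def matrix_matrix_mult_def transpose_def)
qed

lemma inner_orthogonal_left:
  fixes Q A B :: "real^'n^'n"
  assumes "orthogonal_matrix Q"
  shows "(Q ** A) \<bullet> (Q ** B) = A \<bullet> B"
proof -
  have "transpose (Q ** A) ** (Q ** B) = transpose A ** (transpose Q ** Q) ** B"
    by (simp add: matrix_transpose_mul matrix_mul_assoc)
  then show ?thesis
    using assms by (simp add: inner_matrix_eq_trace orthogonal_matrix_def)
qed

lemma inner_orthogonal_right:
  fixes Q A B :: "real^'n^'n"
  assumes "orthogonal_matrix Q"
  shows "(A ** Q) \<bullet> (B ** Q) = A \<bullet> B"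
proof -
  have "trace (transpose Q ** (transpose A ** B ** Q)) = trace (transpose A ** B ** Q ** transpose Q)"
    by (rule trace_mul_sym)
  also have "transpose A ** B ** Q ** transpose Q = transpose A ** B ** (Q ** transpose Q)"
    by (simp add: matrix_mul_assoc)
  also have "\<dots> = transpose A ** B"
    using assms by (simp add: orthogonal_matrix_def)
  finally show ?thesis
    by (simp add: inner_matrix_eq_trace matrix_transpose_mul matrix_mul_assoc)
qed

lemma inner_transpose:
  fixes A B :: "real^'n^'m"
  shows "transpose A \<bullet> transpose B = A \<bullet> B"
  by (simp add: inner_vec_def transpose_def) (rule sum.swap)

lemma linear_matrix_mul_left: "linear (\<lambda>X. A ** X)" for A :: "real^'n^'m"
  by (simp add: linear_iff matrix_add_ldistrib matrix_scalar_ac scalar_matrix_assoc)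

lemma linear_matrix_mul_right: "linear (\<lambda>X. X ** A)" for A :: "real^'n^'m"
  by (simp add: linear_iff scalar_matrix_assoc)
    (simp add: matrix_matrix_mult_def vec_eq_iff sum.distrib distrib_right)

lemma linear_matrix_conj: "linear (\<lambda>X. A ** X ** B)" for A :: "real^'n^'m"
  using linear_compose[OF linear_matrix_mul_left linear_matrix_mul_right] by (simp add: o_def)

lemma linear_transpose: "linear (transpose :: real^'n^'m \<Rightarrow> _)"
  by (simp add: linear_iff transpose_scalar) (simp add: transpose_def vec_eq_iff)

lemma SO3_orthogonal: "A \<in> SO3 \<Longrightarrow> orthogonal_matrix A"
  by (simp add: SO3_def)

lemma SO3_mult: "A \<in> SO3 \<Longrightarrow> B \<in> SO3 \<Longrightarrow> A ** B \<in> SO3"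
  by (simp add: SO3_def orthogonal_matrix_mul det_mul)

lemma SO3_transpose: "A \<in> SO3 \<Longrightarrow> transpose A \<in> SO3"
  by (simp add: SO3_def)

lemma SO3_mat_1: "mat 1 \<in> SO3"
  by (simp add: SO3_def orthogonal_matrix_id)

lemma SO3_cancel:
  assumes "A \<in> SO3"
  shows "transpose A ** A = mat 1" "A ** transpose A = mat 1"
    "transpose A ** (A ** B) = B" "A ** (transpose A ** B) = B"
  using assms by (simp_all add: SO3_def orthogonal_matrix_def matrix_mul_assoc)

lemma inner_SO3_self:
  assumes "A \<in> SO3"
  shows "A \<bullet> A = 3"
  using assms by (simp add: inner_matrix_eq_trace SO3_cancel trace_def mat_def)

text \<open>All rotations lie on one sphere of the matrix space, so distances and inner products
  determine each other.\<close>

lemma dist_SO3: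
  assumes "A \<in> SO3" "B \<in> SO3"
  shows "(dist A B)\<^sup>2 = 6 - 2 * (A \<bullet> B)"
  using assms
  by (simp add: dist_norm power2_norm_eq_inner inner_diff inner_SO3_self inner_commute)

section \<open>Axis-angle form of rotations and Euler's rotation theorem\<close>

definition outer :: "real^3 \<Rightarrow> real^3^3" where
  "outer v = (\<chi> i j. v $ i * v $ j)"

definition hat :: "real^3 \<Rightarrow> real^3^3" where
  "hat v = matrix (cross3 v)"

text \<open>Rodrigues' formula: for a unit vector \<open>v\<close> this is the rotation about the
  axis \<open>v\<close> by the angle \<theta>. There \<open>outer v\<close> is the orthogonal
  projection onto the axis.\<close>

definition rot :: "real^3 \<Rightarrow> real \<Rightarrow> real^3^3" where
  "rot v \<theta> = cos \<theta> *\<^sub>R mat 1 + sin \<theta> *\<^sub>R hat v + (1 - cos \<theta>) *\<^sub>R outer v"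

lemma outer_mult: "outer v *v x = (v \<bullet> x) *\<^sub>R v"
  by (simp add: outer_def matrix_vector_mult_def inner_vec_def vec_eq_iff sum_distrib_left
      sum_distrib_right mult_ac)

lemma hat_component:
  "hat v $ 1 $ 1 = 0" "hat v $ 1 $ 2 = - v $ 3" "hat v $ 1 $ 3 = v $ 2"
  "hat v $ 2 $ 1 = v $ 3" "hat v $ 2 $ 2 = 0" "hat v $ 2 $ 3 = - v $ 1"
  "hat v $ 3 $ 1 = - v $ 2" "hat v $ 3 $ 2 = v $ 1" "hat v $ 3 $ 3 = 0"
  by (simp_all add: hat_def matrix_def cross3_def axis_def)

lemma hat_mult: "hat v *v x = cross3 v x"
  by (simp add: vec_eq_iff forall_3 matrix_vector_mult_def sum_3 hat_component cross3_def)

lemma linear_hat: "linear hat"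
  by (simp add: linear_iff vec_eq_iff forall_3 hat_component)

lemma hat_uminus: "hat (- v) = - hat v"
  using linear_hat by (rule linear_neg)

lemma transpose_hat: "transpose (hat v) = - hat v"
  by (simp add: vec_eq_iff forall_3 hat_component transpose_def)

lemma outer_uminus: "outer (- v) = outer v"
  by (simp add: outer_def)

lemma transpose_outer: "transpose (outer v) = outer v"
  by (simp add: outer_def transpose_def vec_eq_iff)

lemma inner_hat: "hat v \<bullet> hat w = 2 * (v \<bullet> w)"
  by (simp add: inner_vec_def sum_3 hat_component)

lemma hat_inject: "hat v = hat w \<longleftrightarrow> v = w"
proof
  assume "hat v = hat w"
  then have "hat v $ 3 $ 2 = hat w $ 3 $ 2" "hat v $ 1 $ 3 = hat w $ 1 $ 3"
    "hat v $ 2 $ 1 = hat w $ 2 $ 1" by simp_all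
  then show "v = w" by (simp add: hat_component vec_eq_iff forall_3)
qed simp

lemma orthogonal_mult_transpose_mult:
  assumes "orthogonal_matrix Q"
  shows "Q *v (transpose Q *v x) = x"
  using assms by (simp add: matrix_vector_mul_assoc orthogonal_matrix_def del: transpose_matrix_vector)

lemma outer_conj:
  fixes Q :: "real^3^3"
  shows "Q ** outer v ** transpose Q = outer (Q *v v)"
proof -
  have "(Q ** outer v ** transpose Q) *v x = outer (Q *v v) *v x" for x
    by (simp add: matrix_vector_mul_assoc[symmetric] outer_mult dot_lmul_matrix
        matrix_vector_mult_scaleR inner_commute[of v] inner_commute[of "Q *v v"])
  then show ?thesis by (simp add: matrix_eq)
qed

text \<open>Orthogonal maps respect the cross product up to the factor \<open>det Q\<close>. This
  sign later separates the two forms of the classification.\<close>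

lemma hat_conj:
  fixes Q :: "real^3^3"
  assumes "orthogonal_matrix Q"
  shows "Q ** hat v ** transpose Q = det Q *\<^sub>R hat (Q *v v)"
proof -
  have "(Q ** hat v ** transpose Q) *v x = (det Q *\<^sub>R hat (Q *v v)) *v x" for x
  proof -
    have "cross3 (Q *v v) (Q *v (transpose Q *v x)) = det Q *\<^sub>R (Q *v cross3 v (transpose Q *v x))"
      using assms by (rule cross_orthogonal_matrix)
    moreover have "det Q * det Q = 1"
      using det_orthogonal_matrix[OF assms] by auto
    ultimately show ?thesis
      using assms by (simp add: matrix_vector_mul_assoc[symmetric] hat_mult
          orthogonal_mult_transpose_mult scaleR_matrix_vector_assoc[symmetric] del: transpose_matrix_vector)
  qed
  then show ?thesis by (simp add: matrix_eq)
qed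

lemma rot_conj:
  assumes "P \<in> SO3"
  shows "P ** rot v \<theta> ** transpose P = rot (P *v v) \<theta>"
proof -
  have P: "orthogonal_matrix P" "det P = 1"
    using assms by (auto simp: SO3_def)
  have "P ** rot v \<theta> ** transpose P = cos \<theta> *\<^sub>R (P ** transpose P) +
      sin \<theta> *\<^sub>R (P ** hat v ** transpose P) + (1 - cos \<theta>) *\<^sub>R (P ** outer v ** transpose P)"
    unfolding rot_def by (simp add: linear_add[OF linear_matrix_conj] linear_cmul[OF linear_matrix_conj])
  then show ?thesis
    using P hat_conj[OF P(1)] outer_conj by (simp add: rot_def orthogonal_matrix_def)
qed

lemma rot_axis3_component:
  "rot (axis 3 1) \<theta> $ 1 $ 1 = cos \<theta>" "rot (axis 3 1) \<theta> $ 1 $ 2 = - sin \<theta>" "rot (axis 3 1) \<theta> $ 1 $ 3 = 0"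
  "rot (axis 3 1) \<theta> $ 2 $ 1 = sin \<theta>" "rot (axis 3 1) \<theta> $ 2 $ 2 = cos \<theta>" "rot (axis 3 1) \<theta> $ 2 $ 3 = 0"
  "rot (axis 3 1) \<theta> $ 3 $ 1 = 0" "rot (axis 3 1) \<theta> $ 3 $ 2 = 0" "rot (axis 3 1) \<theta> $ 3 $ 3 = 1"
  by (simp_all add: rot_def hat_component outer_def mat_def axis_def)

text \<open>Together with \<open>rot_conj\<close> this reduces questions about an arbitrary axis to
  the third coordinate axis, where the matrix of a rotation is explicit.\<close>

lemma obtain_rotation_to:
  assumes "norm v = 1"
  obtains P where "P \<in> SO3" "P *v axis 3 1 = (v::real^3)"
proof -
  have "2 \<le> CARD(3)" by simp
  from rotation_matrix_exists_basis[OF this assms, of 3] that show ?thesis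
    by (auto simp: SO3_def rotation_matrix_def)
qed

lemma rot_in_SO3:
  assumes "norm v = 1"
  shows "rot v \<theta> \<in> SO3"
proof -
  obtain P where P: "P \<in> SO3" "P *v axis 3 1 = v"
    using assms by (rule obtain_rotation_to)
  have "rot (axis 3 1) \<theta> \<in> SO3"
    by (simp add: SO3_def orthogonal_matrix vec_eq_iff forall_3 matrix_matrix_mult_def sum_3
        transpose_def mat_def det_3 rot_axis3_component flip: power2_eq_square)
  then have "P ** rot (axis 3 1) \<theta> ** transpose P \<in> SO3"
    using P by (intro SO3_mult SO3_transpose)
  then show ?thesis using P by (simp add: rot_conj)
qed

text \<open>The product of \<open>A\<close> and the transpose of \<open>I - A\<close> is
  \<open>A - I\<close>. Since \<open>det A = 1\<close>, the matrices \<open>A - I\<close> and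
  \<open>I - A\<close> have the same determinant, but in odd dimension these determinants are
  opposite; hence both vanish.\<close>

lemma SO3_fixed_vector:
  assumes "A \<in> SO3"
  obtains v where "norm v = 1" "A *v v = v"
proof -
  have "det (A - mat 1) = det (A ** transpose (mat 1 - A))"
    using SO3_cancel(2)[OF assms] by (simp add: linear_diff[OF linear_transpose] linear_diff[OF linear_matrix_mul_left])
  also have "\<dots> = det (mat 1 - A)"
    using assms by (simp add: det_mul SO3_def)
  also have "\<dots> = - det (A - mat 1)"
    by (simp add: det_3 algebra_simps)
  finally have "det (A - mat 1) = 0" by simp
  then have "\<not> invertible (A - mat 1)" by (simp add: invertible_det_nz)
  then obtain x where x: "x \<noteq> 0" "(A - mat 1) *v x = 0"
    by (metis invertible_left_inverse matrix_left_invertible_ker)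
  show thesis
  proof
    show "norm (x /\<^sub>R norm x) = 1" using x by simp
    show "A *v (x /\<^sub>R norm x) = x /\<^sub>R norm x"
      using x by (simp add: matrix_vector_mult_diff_rdistrib matrix_vector_mult_scaleR)
  qed
qed

text \<open>A rotation \<open>P\<close> taking the third axis to a fixed vector of \<open>A\<close>
  conjugates \<open>A\<close> to a matrix \<open>B\<close> that fixes the third axis. What remains
  is a 2 by 2 block with orthonormal columns and determinant 1, hence a plane rotation.\<close>

lemma SO3_euler:
  assumes "A \<in> SO3"
  obtains v \<theta> where "norm v = 1" "A = rot v \<theta>"
proof -
  obtain v where v: "norm v = 1" "A *v v = v" using assms by (rule SO3_fixed_vector)
  obtain P where P: "P \<in> SO3" "P *v axis 3 1 = v" using v(1) by (rule obtain_rotation_to)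
  define B where "B = transpose P ** A ** P"
  have A: "A = P ** B ** transpose P"
    by (simp add: B_def matrix_mul_assoc SO3_cancel P)
      (simp add: SO3_cancel P flip: matrix_mul_assoc)
  have BS: "B \<in> SO3" using P assms by (simp add: B_def SO3_mult SO3_transpose)
  have Pv: "transpose P *v v = axis 3 1"
    using P by (simp add: matrix_vector_mul_assoc SO3_cancel flip: P(2))
  have B3: "B *v axis 3 1 = axis 3 1"
    using v Pv by (simp add: B_def P flip: matrix_vector_mul_assoc)
  \<comment> \<open>The transpose fixes the axis as well, so both the third column and the third row
    of \<open>B\<close> agree with those of the identity.\<close>
  then have "transpose B *v (B *v axis 3 1) = transpose B *v axis 3 1" by simp
  then have B3': "transpose B *v axis 3 1 = axis 3 1"
    using BS by (simp add: matrix_vector_mul_assoc SO3_cancel)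
  have c: "B $ 1 $ 3 = 0" "B $ 2 $ 3 = 0" "B $ 3 $ 3 = 1" "B $ 3 $ 1 = 0" "B $ 3 $ 2 = 0"
    using B3 B3' by (simp_all add: vec_eq_iff forall_3 matrix_vector_mult_def sum_3 axis_def transpose_def)
  have "transpose B ** B = mat 1" "det B = 1"
    using BS by (simp_all add: SO3_def orthogonal_matrix_def)
  then have e: "B$1$1 * B$1$1 + B$2$1 * B$2$1 = 1" "B$1$1 * B$1$2 + B$2$1 * B$2$2 = 0"
    "B$1$2 * B$1$2 + B$2$2 * B$2$2 = 1" "B$1$1 * B$2$2 - B$1$2 * B$2$1 = 1"
    by (simp_all add: vec_eq_iff forall_3 matrix_matrix_mult_def sum_3 transpose_def mat_def c det_3)
  have d: "B$2$2 = B$1$1" "B$1$2 = - B$2$1"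
    using e by algebra+
  from e(1) obtain \<theta> where t: "B$1$1 = cos \<theta>" "B$2$1 = sin \<theta>"
    using sincos_total_2pi[of "B$1$1" "B$2$1"] by (auto simp: power2_eq_square)
  have "B = rot (axis 3 1) \<theta>"
    by (simp add: vec_eq_iff forall_3 rot_axis3_component c d t)
  then have "A = rot v \<theta>"
    using rot_conj[OF P(1), of "axis 3 1" \<theta>] A P by simp
  with v(1) that show thesis by blast
qed

lemma inner_rot_mat_1:
  assumes "norm v = 1"
  shows "rot v \<theta> \<bullet> mat 1 = 1 + 2 * cos \<theta>"
proof -
  have "v $ 1 * v $ 1 + v $ 2 * v $ 2 + v $ 3 * v $ 3 = 1"
    using assms by (simp add: norm_eq_1 inner_vec_def sum_3)
  then have "(1 - cos \<theta>) * (v $ 1 * v $ 1 + v $ 2 * v $ 2 + v $ 3 * v $ 3) = 1 - cos \<theta>" by simp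
  then show ?thesis
    by (simp add: inner_vec_def sum_3 rot_def hat_component mat_def outer_def algebra_simps)
qed

section \<open>The distance as a function of the rotation angle\<close>

lemma ctranspose_mult: "ctranspose (A ** B) = ctranspose B ** ctranspose A"
  by (simp add: ctranspose_def transpose_def vec_eq_iff matrix_matrix_mult_def map_matrix_def mult.commute)

lemma ctranspose_ctranspose: "ctranspose (ctranspose A) = A"
  by (simp add: ctranspose_def vec_eq_iff map_matrix_def transpose_def)

lemma unitary_matrix_mult:
  fixes U V :: "complex^'n^'n"
  assumes "unitary_matrix U" "unitary_matrix V"
  shows "unitary_matrix (U ** V)"
proof -
  have "ctranspose V ** ctranspose U ** (U ** V) = ctranspose V ** (ctranspose U ** U) ** V"
    "U ** V ** (ctranspose V ** ctranspose U) = U ** (V ** ctranspose V) ** ctranspose U"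
    by (simp_all add: matrix_mul_assoc)
  then show ?thesis
    using assms by (simp add: unitary_matrix_def ctranspose_mult)
qed

lemma frobenius_norm_trace: "(frobenius_norm M)\<^sup>2 = Re (trace (ctranspose M ** M))"
proof -
  have "(frobenius_norm M)\<^sup>2 = (\<Sum>i\<in>UNIV. \<Sum>j\<in>UNIV. (cmod (M $ i $ j))\<^sup>2)"
    unfolding frobenius_norm_def by (simp add: sum_nonneg)
  also have "\<dots> = (\<Sum>j\<in>UNIV. \<Sum>i\<in>UNIV. (cmod (M $ i $ j))\<^sup>2)"
    by (rule sum.swap)
  also have "\<dots> = (\<Sum>j\<in>UNIV. \<Sum>i\<in>UNIV. Re (cnj (M $ i $ j) * M $ i $ j))"
    by (simp add: cmod_power2 flip: power2_eq_square)
  finally show ?thesis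
    by (simp add: trace_def matrix_matrix_mult_def ctranspose_def map_matrix_def transpose_def)
qed

lemma frobenius_norm_unitary:
  assumes "unitary_matrix U"
  shows "frobenius_norm (U ** M ** ctranspose U) = frobenius_norm M"
proof -
  have "trace (ctranspose (U ** M ** ctranspose U) ** (U ** M ** ctranspose U))
      = trace (U ** (ctranspose M ** (ctranspose U ** U) ** M ** ctranspose U))"
    by (simp add: ctranspose_mult ctranspose_ctranspose matrix_mul_assoc)
  also have "\<dots> = trace (ctranspose M ** (ctranspose U ** U) ** M ** ctranspose U ** U)"
    by (rule trace_mul_sym)
  also have "\<dots> = trace (ctranspose M ** (ctranspose U ** U) ** M ** (ctranspose U ** U))"
    by (simp add: matrix_mul_assoc)
  also have "\<dots> = trace (ctranspose M ** M)"
    using assms by (simp add: unitary_matrix_def)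
  finally have "(frobenius_norm (U ** M ** ctranspose U))\<^sup>2 = (frobenius_norm M)\<^sup>2"
    by (simp add: frobenius_norm_trace)
  then show ?thesis
    by (simp add: frobenius_norm_eq_norm)
qed

section \<open>Rotations diagonalized over the complex numbers\<close>

lemma map_matrix_of_real_mult:
  "map_matrix complex_of_real (A ** B) = map_matrix complex_of_real A ** map_matrix complex_of_real B"
  by (simp add: map_matrix_def matrix_matrix_mult_def vec_eq_iff)

lemma ctranspose_of_real:
  "ctranspose (map_matrix complex_of_real A) = map_matrix complex_of_real (transpose A)"
  by (simp add: map_matrix_def transpose_def ctranspose_def vec_eq_iff)

lemma unitary_matrix_of_real:
  assumes "orthogonal_matrix P"
  shows "unitary_matrix (map_matrix complex_of_real P)"
proof -
  have "map_matrix complex_of_real (mat 1) = mat 1"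
    by (simp add: map_matrix_def mat_def vec_eq_iff)
  then show ?thesis
    using assms
    by (simp add: unitary_matrix_def ctranspose_of_real orthogonal_matrix_def
        flip: map_matrix_of_real_mult)
qed

text \<open>The columns are unit eigenvectors, common to all rotations about the third axis, for the
  eigenvalues \<open>cis \<theta>\<close>, \<open>cis (- \<theta>)\<close> and 1.\<close>

definition eig_basis :: "complex^3^3" where
  "eig_basis = vector [vector [1 / sqrt 2, 1 / sqrt 2, 0],
     vector [- \<i> / sqrt 2, \<i> / sqrt 2, 0], vector [0, 0, 1]]"

lemma eig_basis_component:
  "eig_basis $ 1 $ 1 = 1 / sqrt 2" "eig_basis $ 1 $ 2 = 1 / sqrt 2" "eig_basis $ 1 $ 3 = 0"
  "eig_basis $ 2 $ 1 = - \<i> / sqrt 2" "eig_basis $ 2 $ 2 = \<i> / sqrt 2" "eig_basis $ 2 $ 3 = 0"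
  "eig_basis $ 3 $ 1 = 0" "eig_basis $ 3 $ 2 = 0" "eig_basis $ 3 $ 3 = 1"
  by (simp_all add: eig_basis_def)

lemma sqrt2_mult_sqrt2: "complex_of_real (sqrt 2) * complex_of_real (sqrt 2) = 2"
  by (simp flip: of_real_mult)

lemma unitary_eig_basis: "unitary_matrix eig_basis"
  by (simp add: unitary_matrix_def ctranspose_def map_matrix_def transpose_def vec_eq_iff forall_3
      matrix_matrix_mult_def sum_3 eig_basis_component mat_def sqrt2_mult_sqrt2)

lemma rot_axis3_diag:
  "map_matrix complex_of_real (rot (axis 3 1) \<theta>) =
     eig_basis ** diag_matrix (vector [cis \<theta>, cis (- \<theta>), 1]) ** ctranspose eig_basis"
  by (simp add: ctranspose_def map_matrix_def transpose_def vec_eq_iff forall_3 diag_matrix_def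
      matrix_matrix_mult_def sum_3 eig_basis_component rot_axis3_component complex_eq_iff)

lemma frobenius_norm_diag:
  "(frobenius_norm (diag_matrix z))\<^sup>2 = (\<Sum>i\<in>UNIV. (cmod (z $ i))\<^sup>2)" for z :: "complex^'n"
  by (simp add: frobenius_norm_def diag_matrix_def sum_nonneg if_distrib[of "\<lambda>x. (cmod x)\<^sup>2"] cong: if_cong)

text \<open>The squared Frobenius norm of \<open>f\<close> applied to a rotation by the angle
  \<open>t\<close>, when \<open>f 1 = 0\<close> removes the contribution of the eigenvalue
  1.\<close>

definition profile :: "(complex \<Rightarrow> complex) \<Rightarrow> real \<Rightarrow> real" where
  "profile f t = (cmod (f (cis t)))\<^sup>2 + (cmod (f (cis (- t))))\<^sup>2"

text \<open>A rotation determines its angle only up to sign and multiples of a full turn, because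
  the axis can be reversed. The profile is even, so it ignores this ambiguity.\<close>

lemma profile_cos_cong:
  assumes "cos s = cos t"
  shows "profile f s = profile f t"
proof -
  have "(sin s)\<^sup>2 = (sin t)\<^sup>2"
    using assms by (simp add: sin_squared_eq)
  then have "sin s = sin t \<or> sin s = - sin t"
    by (simp add: power2_eq_iff)
  then have "cis s = cis t \<and> cis (- s) = cis (- t) \<or> cis s = cis (- t) \<and> cis (- s) = cis t"
    using assms by (auto simp: complex_eq_iff)
  then show ?thesis
    by (auto simp: profile_def)
qed

text \<open>A real rotation \<open>P\<close> moves the third axis to \<open>v\<close>; its product
  with \<open>eig_basis\<close> diagonalizes \<open>rot v \<theta>\<close>, and the unitary factors
  drop out of the norm.\<close>

lemma frobenius_norm_matrix_fun_rot:
  assumes "norm v = 1" "f 1 = 0"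
  shows "(frobenius_norm (matrix_fun f (map_matrix complex_of_real (rot v \<theta>))))\<^sup>2 = profile f \<theta>"
proof -
  obtain P where P: "P \<in> SO3" "P *v axis 3 1 = v"
    using assms(1) by (rule obtain_rotation_to)
  define U where "U = map_matrix complex_of_real P ** eig_basis"
  define z :: "complex^3" where "z = vector [cis \<theta>, cis (- \<theta>), 1]"
  have U: "unitary_matrix U"
    unfolding U_def using P
    by (intro unitary_matrix_mult unitary_matrix_of_real SO3_orthogonal unitary_eig_basis)
  have "rot v \<theta> = P ** rot (axis 3 1) \<theta> ** transpose P"
    using P by (simp add: rot_conj)
  then have "map_matrix complex_of_real (rot v \<theta>) = U ** diag_matrix z ** ctranspose U"
    by (simp add: map_matrix_of_real_mult rot_axis3_diag U_def z_def ctranspose_mult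
        ctranspose_of_real matrix_mul_assoc)
  then show ?thesis
    using U assms(2)
    by (simp add: matrix_fun_unitary_diag frobenius_norm_unitary frobenius_norm_diag sum_3 z_def
        profile_def)
qed

lemma SO3_relative_rotation:
  assumes "A \<in> SO3" "B \<in> SO3"
  obtains v \<theta> where "norm v = 1" "transpose A ** B = rot v \<theta>" "A \<bullet> B = 1 + 2 * cos \<theta>"
proof -
  have "transpose A ** B \<in> SO3"
    using assms by (simp add: SO3_mult SO3_transpose)
  then obtain v \<theta> where v: "norm v = 1" "transpose A ** B = rot v \<theta>"
    by (rule SO3_euler)
  have "A \<bullet> B = mat 1 \<bullet> rot v \<theta>"
    by (simp add: inner_matrix_eq_trace flip: v(2))
  then show thesis
    using v that by (simp add: inner_commute[of "mat 1"] inner_rot_mat_1)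
qed

section \<open>The angle between two rotations\<close>

lemma inner_SO3_bounds:
  assumes "A \<in> SO3" "B \<in> SO3"
  shows "- 1 \<le> A \<bullet> B" "A \<bullet> B \<le> 3"
proof -
  obtain v \<theta> where "A \<bullet> B = 1 + 2 * cos \<theta>"
    using assms by (rule SO3_relative_rotation)
  then show "- 1 \<le> A \<bullet> B" "A \<bullet> B \<le> 3"
    using cos_ge_minus_one[of \<theta>] cos_le_one[of \<theta>] by linarith+
qed

text \<open>The solution in [0, pi] of \<open>A \<bullet> B = 1 + 2 * cos \<theta>\<close>. As a
  function of the inner product alone, it is preserved by every map that preserves inner
  products.\<close>

definition SO3_angle :: "real^3^3 \<Rightarrow> real^3^3 \<Rightarrow> real" where
  "SO3_angle A B = arccos ((A \<bullet> B - 1) / 2)"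

lemma SO3_angle_bounds:
  assumes "A \<in> SO3" "B \<in> SO3"
  shows "0 \<le> SO3_angle A B" "SO3_angle A B \<le> pi"
  using inner_SO3_bounds[OF assms] by (auto simp: SO3_angle_def intro!: arccos_lbound arccos_ubound)

lemma inner_eq_cos_angle:
  assumes "A \<in> SO3" "B \<in> SO3"
  shows "A \<bullet> B = 1 + 2 * cos (SO3_angle A B)"
  using inner_SO3_bounds[OF assms] by (simp add: SO3_angle_def field_simps)

lemma dist_Nf_eq_profile:
  assumes N: "\<And>M. N M = c * frobenius_norm M" and "f 1 = 0" and AB: "A \<in> SO3" "B \<in> SO3"
  shows "dist_Nf N f A B = c * sqrt (profile f (SO3_angle A B))"
proof -
  obtain v \<theta> where v: "norm v = 1" "transpose A ** B = rot v \<theta>" "A \<bullet> B = 1 + 2 * cos \<theta>"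
    using AB by (rule SO3_relative_rotation)
  have "profile f (SO3_angle A B) = profile f \<theta>"
    using v(3) inner_eq_cos_angle[OF AB] by (intro profile_cos_cong) simp
  then have "(frobenius_norm (matrix_fun f (map_matrix complex_of_real (rot v \<theta>))))\<^sup>2 = profile f (SO3_angle A B)"
    using frobenius_norm_matrix_fun_rot[where f = f, OF v(1) \<open>f 1 = 0\<close>] by simp
  moreover have "dist_Nf N f A B = c * frobenius_norm (matrix_fun f (map_matrix complex_of_real (rot v \<theta>)))"
    using AB by (simp add: dist_Nf_def N matrix_inv_orthogonal SO3_orthogonal v(2))
  moreover have "frobenius_norm M = sqrt ((frobenius_norm M)\<^sup>2)" for M :: "complex^3^3"
    by (simp add: frobenius_norm_eq_norm)
  ultimately show ?thesis by metis
qed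

section \<open>The angular profile near zero\<close>

lemma has_vector_derivative_slope:
  assumes "(p has_vector_derivative d) (at 0)" and "p 0 = 0"
  shows "((\<lambda>t. p t /\<^sub>R t) \<longlongrightarrow> d) (at 0)"
proof -
  have 1: "((\<lambda>t. norm (p t - t *\<^sub>R d) / norm t) \<longlongrightarrow> 0) (at 0)"
    using assms by (simp add: has_vector_derivative_def has_derivative_iff_norm)
  have eq: "norm (p t - t *\<^sub>R d) / norm t = norm (p t /\<^sub>R t - d)" if "t \<noteq> 0" for t
  proof -
    have "p t /\<^sub>R t - d = (p t - t *\<^sub>R d) /\<^sub>R t"
      using that by (simp add: scaleR_diff_right)
    then show ?thesis by (simp add: divide_inverse mult.commute)
  qed
  have "((\<lambda>t. norm (p t /\<^sub>R t - d)) \<longlongrightarrow> 0) (at 0)"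
    by (rule Lim_transform_eventually[OF 1], rule eventually_mono[OF eventually_neq_at_within], rule eq)
  then have "((\<lambda>t. p t /\<^sub>R t - d) \<longlongrightarrow> 0) (at 0)"
    by (rule tendsto_norm_zero_cancel)
  then show ?thesis
    by (rule LIM_zero_cancel)
qed

text \<open>The even function \<open>q\<close> has derivative \<open>e\<close>, which vanishes at 0,
  so the sign of \<open>e\<close> near 0 is read off from \<open>e t / t\<close>. Since
  \<open>p t / t\<close> tends to \<open>d 0\<close>, this quotient tends to four times the squared
  norm of \<open>d 0\<close>, which is positive.\<close>

lemma even_norm_square_increasing:
  fixes p :: "real \<Rightarrow> 'a::real_inner"
  assumes "0 < \<tau>" and p0: "p 0 = 0" and d0: "d 0 \<noteq> 0" and cont: "isCont d 0"
    and deriv: "\<And>t. \<bar>t\<bar> < \<tau> \<Longrightarrow> (p has_vector_derivative d t) (at t)"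
  obtains t0 where "0 < t0" "t0 < \<tau>"
    "\<And>s t. 0 \<le> s \<Longrightarrow> s < t \<Longrightarrow> t \<le> t0 \<Longrightarrow>
       (norm (p s))\<^sup>2 + (norm (p (- s)))\<^sup>2 < (norm (p t))\<^sup>2 + (norm (p (- t)))\<^sup>2"
proof -
  define q where "q t = p t \<bullet> p t + p (- t) \<bullet> p (- t)" for t
  define e where "e t = 2 * (p t \<bullet> d t) - 2 * (p (- t) \<bullet> d (- t))" for t
  have dq: "(q has_real_derivative e t) (at t)" if "\<bar>t\<bar> < \<tau>" for t
  proof -
    have 1: "(p has_derivative (\<lambda>h. h *\<^sub>R d t)) (at t)"
      using deriv[OF that] by (simp add: has_vector_derivative_def)
    have "(p has_derivative (\<lambda>h. h *\<^sub>R d (- t))) (at (- t))"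
      using deriv[of "- t"] that by (simp add: has_vector_derivative_def)
    then have 2: "((\<lambda>t. p (- t)) has_derivative (\<lambda>h. (- h) *\<^sub>R d (- t))) (at t)"
      by (rule has_derivative_compose[of uminus uminus, rotated]) (auto intro!: derivative_eq_intros)
    have "(q has_derivative (\<lambda>h. e t * h)) (at t)"
      unfolding q_def
      by (rule derivative_eq_intros 1 2 refl)+
        (auto simp: e_def algebra_simps inner_commute)
    then show ?thesis
      by (simp add: has_field_derivative_def)
  qed
  have s: "((\<lambda>t. p t /\<^sub>R t) \<longlongrightarrow> d 0) (at 0)"
    using deriv[of 0] p0 \<open>0 < \<tau>\<close> by (intro has_vector_derivative_slope) auto
  have c: "(d \<longlongrightarrow> d 0) (at 0)"
    using cont by (simp add: isCont_def)
  have flip: "filterlim uminus (at 0) (at (0::real))"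
    by (simp add: filterlim_def filtermap_at_minus)
  \<comment> \<open>This is \<open>e t / t\<close>, with the minus sign of the second term of
    \<open>e\<close> moved into the slope at \<open>- t\<close>, so that both slopes tend to
    \<open>d 0\<close>.\<close>
  have "((\<lambda>t. 2 * ((p t /\<^sub>R t) \<bullet> d t) + 2 * ((p (- t) /\<^sub>R (- t)) \<bullet> d (- t)))
      \<longlongrightarrow> 2 * (d 0 \<bullet> d 0) + 2 * (d 0 \<bullet> d 0)) (at 0)"
    by (intro tendsto_intros s c filterlim_compose[OF s flip] filterlim_compose[OF c flip])
  then have "((\<lambda>t. e t / t) \<longlongrightarrow> 4 * (d 0 \<bullet> d 0)) (at 0)"
    by (simp add: e_def divide_inverse algebra_simps)
  moreover have "4 * (d 0 \<bullet> d 0) > 0"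
    using d0 by simp
  ultimately have "\<forall>\<^sub>F t in at 0. e t / t > 0"
    by (rule order_tendstoD)
  then obtain \<eta> where \<eta>: "\<eta> > 0" "\<And>t. t \<noteq> 0 \<Longrightarrow> \<bar>t\<bar> < \<eta> \<Longrightarrow> e t / t > 0"
    by (auto simp: eventually_at)
  define t0 where "t0 = min \<tau> \<eta> / 2"
  have t0: "0 < t0" "t0 < \<tau>" "t0 < \<eta>"
    using \<eta>(1) \<open>0 < \<tau>\<close> by (auto simp: t0_def)
  have "q s < q t" if "0 \<le> s" "s < t" "t \<le> t0" for s t
  proof (rule DERIV_pos_imp_increasing_open[OF \<open>s < t\<close>])
    show "\<exists>y. DERIV q x :> y \<and> y > 0" if "s < x" "x < t" for x
    proof (intro exI conjI)
      show "DERIV q x :> e x"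
        using that \<open>0 \<le> s\<close> \<open>t \<le> t0\<close> t0 by (intro dq) auto
      have "e x / x > 0" "x > 0"
        using that \<open>0 \<le> s\<close> \<open>t \<le> t0\<close> t0 by (auto intro!: \<eta>)
      then show "e x > 0"
        by (simp add: zero_less_divide_iff)
    qed
    show "continuous_on {s..t} q"
    proof (rule DERIV_continuous_on[where D = e])
      show "(q has_real_derivative e x) (at x within {s..t})" if "x \<in> {s..t}" for x
        using that \<open>0 \<le> s\<close> \<open>t \<le> t0\<close> t0 by (intro has_field_derivative_at_within[OF dq]) auto
    qed
  qed
  then show thesis
    using t0 that by (auto simp: q_def power2_norm_eq_inner)
qed

text \<open>Composing the power series with \<open>cis\<close> gives a curve \<open>p\<close>
  through 0 with velocity \<open>\<i> * a 1\<close> at 0, which is nonzero; the preceding lemma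
  applies to it.\<close>

lemma profile_strict_mono_near_0:
  assumes "conformal_near_1 f" and "f 1 = 0"
  obtains t0 where "0 < t0" "t0 < pi"
    "\<And>s t. 0 \<le> s \<Longrightarrow> s < t \<Longrightarrow> t \<le> t0 \<Longrightarrow> profile f s < profile f t"
proof -
  obtain a r where r: "r > 0" and a1: "a 1 \<noteq> 0"
    and sums: "\<And>z. z \<in> sphere 0 1 \<Longrightarrow> dist z 1 < r \<Longrightarrow> (\<lambda>k::nat. a k * (z - 1) ^ k) sums f z"
    using assms(1) by (auto simp: conformal_near_1_def)
  have cis_lim: "((\<lambda>t. dist (cis t) 1) \<longlongrightarrow> 0) (at 0)"
    by (rule tendsto_eq_intros refl | simp)+
  have "\<forall>\<^sub>F t in at 0. dist (cis t) 1 < r"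
    using cis_lim r by (rule order_tendstoD)
  moreover have "\<forall>\<^sub>F t in at (0::real). t \<noteq> 0 \<and> \<bar>t\<bar> < pi"
    by (auto simp: eventually_at intro!: exI[of _ pi])
  ultimately have "\<forall>\<^sub>F t in at 0. dist (cis t) 1 < r \<and> t \<noteq> 0 \<and> \<bar>t\<bar> < pi"
    by (rule eventually_conj)
  \<comment> \<open>The series is known to converge only at points of the circle. One such point
    other than 1 gives convergence in a full disc of radius \<open>norm K\<close> about 0 in the
    variable \<open>z - 1\<close>.\<close>
  then obtain u where u: "dist (cis u) 1 < r" "u \<noteq> 0" "\<bar>u\<bar> < pi"
    using eventually_happens[of _ "at (0::real)"] by auto
  define K where "K = cis u - 1"
  have "K \<noteq> 0"
  proof
    assume "K = 0"
    then have "cos \<bar>u\<bar> = cos 0" by (simp add: K_def complex_eq_iff)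
    then show False using cos_inj_pi[of "\<bar>u\<bar>" 0] u by simp
  qed
  have sK: "summable (\<lambda>n. a n * K ^ n)"
    using sums[of "cis u"] u by (auto simp: K_def sums_iff)
  define F where "F w = (\<Sum>n. a n * w ^ n)" for w
  define F' where "F' w = (\<Sum>n. diffs a n * w ^ n)" for w
  have dF: "DERIV F w :> F' w" if "norm w < norm K" for w
    unfolding F_def F'_def using sK that by (rule termdiffs_strong)
  \<comment> \<open>Convergence of the differentiated series at \<open>K\<close> itself is not
    guaranteed; the interior point \<open>K / 2\<close> suffices for continuity at 0.\<close>
  have "summable (\<lambda>n. diffs a n * (K / 2) ^ n)"
    using sK \<open>K \<noteq> 0\<close> by (intro termdiff_converges[of _ "norm K"] powser_inside[OF sK]) (auto simp: norm_divide)
  then have cF': "isCont F' 0"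
    unfolding F'_def by (rule isCont_powser) (use \<open>K \<noteq> 0\<close> in simp)
  \<comment> \<open>Within \<open>r\<close> the series represents \<open>f\<close>; within
    \<open>norm K\<close> its sum is differentiable.\<close>
  define \<rho> where "\<rho> = min r (norm K)"
  have "\<rho> > 0" using r \<open>K \<noteq> 0\<close> by (simp add: \<rho>_def)
  have "\<forall>\<^sub>F t in at 0. dist (cis t) 1 < \<rho>"
    using cis_lim \<open>\<rho> > 0\<close> by (rule order_tendstoD)
  then obtain \<sigma> where \<sigma>: "\<sigma> > 0" "\<And>t. t \<noteq> 0 \<Longrightarrow> \<bar>t\<bar> < \<sigma> \<Longrightarrow> dist (cis t) 1 < \<rho>"
    by (auto simp: eventually_at)
  define \<tau> where "\<tau> = min \<sigma> pi"
  have near: "dist (cis t) 1 < \<rho>" if "\<bar>t\<bar> < \<tau>" for t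
    using \<sigma>(2)[of t] that \<open>\<rho> > 0\<close> by (cases "t = 0") (auto simp: \<tau>_def)
  define p where "p t = F (cis t - 1)" for t
  define d where "d t = \<i> * cis t * F' (cis t - 1)" for t
  have fp: "f (cis t) = p t" if "\<bar>t\<bar> < \<tau>" for t
    using sums[of "cis t"] near[OF that] by (simp add: p_def F_def \<rho>_def sums_iff)
  have cis0: "isCont cis 0"
    using continuous_on_eq_continuous_at[of UNIV cis] by (auto intro!: continuous_intros)
  then have "isCont (\<lambda>t. cis t - 1) 0"
    by (intro isCont_diff continuous_const)
  moreover have "isCont F' (cis 0 - 1)"
    using cF' by simp
  ultimately have "isCont (\<lambda>t. F' (cis t - 1)) 0"
    by (rule isCont_o2)
  then have d_cont: "isCont d 0"
    unfolding d_def[abs_def] by (intro continuous_intros cis0)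
  have "(p has_vector_derivative d t) (at t)" if "\<bar>t\<bar> < \<tau>" for t
  proof -
    have "((\<lambda>t. cis t - 1) has_vector_derivative \<i> * cis t) (at t)"
      unfolding has_vector_derivative_complex_iff
      by (auto intro!: derivative_eq_intros)
    moreover have "DERIV F (cis t - 1) :> F' (cis t - 1)"
      using near[OF that] by (intro dF) (simp add: \<rho>_def dist_norm)
    ultimately have "((F \<circ> (\<lambda>t. cis t - 1)) has_vector_derivative (\<i> * cis t) * F' (cis t - 1)) (at t)"
      by (rule field_vector_diff_chain_at)
    then show ?thesis by (simp add: o_def p_def[abs_def] d_def)
  qed
  moreover note d_cont
  moreover have "d 0 \<noteq> 0"
    using a1 by (simp add: d_def F'_def diffs_def)
  moreover have "p 0 = 0"
    using fp[of 0] \<open>f 1 = 0\<close> \<sigma>(1) by (simp add: \<tau>_def)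
  moreover have "0 < \<tau>"
    using \<sigma>(1) by (simp add: \<tau>_def)
  ultimately obtain t0 where t0: "0 < t0" "t0 < \<tau>"
    "\<And>s t. 0 \<le> s \<Longrightarrow> s < t \<Longrightarrow> t \<le> t0 \<Longrightarrow>
       (norm (p s))\<^sup>2 + (norm (p (- s)))\<^sup>2 < (norm (p t))\<^sup>2 + (norm (p (- t)))\<^sup>2"
    using even_norm_square_increasing[of \<tau> p d] by metis
  show thesis
  proof
    show "0 < t0" "t0 < pi" using t0 by (auto simp: \<tau>_def)
    show "profile f s < profile f t" if "0 \<le> s" "s < t" "t \<le> t0" for s t
      using t0(3)[OF that] that t0(2) fp[of s] fp[of "- s"] fp[of t] fp[of "- t"]
      by (simp add: profile_def)
  qed
qed

text \<open>The profile may take a value several times on [0, pi], but away from 0 it has a positive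
  lower bound \<open>m\<close>: by compactness on the middle part, by the one-sided limits near pi,
  and by its own value at pi. Values below \<open>m\<close> therefore come only from the range where
  it is strictly increasing.\<close>

lemma profile_locally_rigid:
  assumes f1: "\<forall>z\<in>sphere 0 1. f z = 0 \<longleftrightarrow> z = 1"
    and f2: "conformal_near_1 f"
    and f3: "continuous_on (sphere 0 1 - {-1}) f"
    and f4: "((\<lambda>t. f (exp (\<i> * complex_of_real t))) \<longlongrightarrow> f (-1)) (at_left pi)"
    and f5: "L \<noteq> 0" "((\<lambda>t. f (exp (\<i> * complex_of_real t))) \<longlongrightarrow> L) (at_right (-pi))"
  obtains \<epsilon> where "0 < \<epsilon>" "\<epsilon> < pi"
    "\<And>s t. s \<in> {0..pi} \<Longrightarrow> t \<in> {0..\<epsilon>} \<Longrightarrow> profile f s = profile f t \<Longrightarrow> s = t"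
proof -
  have f0: "f 1 = 0" and fm1: "f (-1) \<noteq> 0"
    using f1 by auto
  obtain t0 where t0: "0 < t0" "t0 < pi"
    "\<And>s t. 0 \<le> s \<Longrightarrow> s < t \<Longrightarrow> t \<le> t0 \<Longrightarrow> profile f s < profile f t"
    using f2 f0 by (rule profile_strict_mono_near_0) blast
  have cis1: "cis t \<noteq> 1" if "0 < t" "t \<le> pi" for t
  proof
    assume "cis t = 1"
    then have "cos t = cos 0" by (simp add: complex_eq_iff)
    then show False using cos_inj_pi[of t 0] that by simp
  qed
  have pos: "profile f t > 0" if "0 < t" "t \<le> pi" for t
    using f1 cis1[OF that] by (auto simp: profile_def intro!: add_pos_nonneg)
  have "continuous_on {-pi<..<pi} (\<lambda>t. f (cis t))"
  proof (rule continuous_on_compose2[OF f3])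
    show "continuous_on {-pi<..<pi} cis"
      by (intro continuous_intros)
    have "cis t \<noteq> -1" if "\<bar>t\<bar> < pi" for t
    proof
      assume "cis t = -1"
      then have "cos \<bar>t\<bar> = cos pi" by (simp add: complex_eq_iff)
      then show False using cos_inj_pi[of "\<bar>t\<bar>" pi] that by simp
    qed
    then show "cis ` {-pi<..<pi} \<subseteq> sphere 0 1 - {-1}" by auto
  qed
  then have "continuous_on {-pi<..<pi} (profile f)"
    unfolding profile_def[abs_def]
    by (intro continuous_intros) (auto elim!: continuous_on_compose2 intro!: continuous_intros)
  then have cont: "isCont (profile f) t" if "\<bar>t\<bar> < pi" for t
    using that by (subst (asm) continuous_on_eq_continuous_at) (auto simp: abs_less_iff)
  have "((\<lambda>t. f (cis (- t))) \<longlongrightarrow> L) (at_left pi)"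
    using f5(2) by (simp add: at_left_minus[of pi] filterlim_filtermap cis_conv_exp)
  moreover have "((\<lambda>t. f (cis t)) \<longlongrightarrow> f (-1)) (at_left pi)"
    using f4 by (simp add: cis_conv_exp)
  ultimately have "(profile f \<longlongrightarrow> (cmod (f (-1)))\<^sup>2 + (cmod L)\<^sup>2) (at_left pi)"
    unfolding profile_def[abs_def] by (intro tendsto_intros)
  \<comment> \<open>As \<open>f (-1)\<close> is nonzero, \<open>l\<close> lies strictly below the
    limit of the profile at pi.\<close>
  moreover define l where "l = (cmod L)\<^sup>2"
  have "l < (cmod (f (-1)))\<^sup>2 + (cmod L)\<^sup>2" and "l > 0"
    using fm1 f5(1) by (auto simp: l_def)
  ultimately have "\<forall>\<^sub>F t in at_left pi. l < profile f t"
    using order_tendstoD(1) by blast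
  then obtain t1 where t1: "t1 < pi" "\<And>t. t1 < t \<Longrightarrow> t < pi \<Longrightarrow> l < profile f t"
    by (auto simp: eventually_at_left[OF pi_gt_zero])
  define t2 where "t2 = max t0 t1"
  have t2: "t0 \<le> t2" "t2 < pi" "t1 \<le> t2"
    using t0 t1 by (auto simp: t2_def)
  have "continuous_on {t0..t2} (profile f)"
    using t0 t2 by (intro continuous_at_imp_continuous_on) (auto intro!: cont)
  then obtain u where u: "u \<in> {t0..t2}" "\<And>t. t \<in> {t0..t2} \<Longrightarrow> profile f u \<le> profile f t"
    using continuous_attains_inf[of "{t0..t2}" "profile f"] t2 by auto
  \<comment> \<open>The value at pi enters separately: \<open>f\<close> may jump at -1, and then the
    profile at pi, twice the squared modulus of \<open>f (-1)\<close>, need not be its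
    limit.\<close>
  define m where "m = min (profile f u) (min l (profile f pi))"
  have "m > 0"
    using u t0 t2 pos \<open>l > 0\<close> by (auto simp: m_def)
  have m: "m \<le> profile f t" if t: "t0 \<le> t" "t \<le> pi" for t
  proof -
    consider "t \<le> t2" | "t2 < t" "t < pi" | "t = pi" using t(2) by linarith
    then show ?thesis
    proof cases
      case 1 then show ?thesis using u(2)[of t] t by (auto simp: m_def)
    next
      case 2 then show ?thesis using t1(2)[of t] t2 by (auto simp: m_def)
    next
      case 3 then show ?thesis by (simp add: m_def)
    qed
  qed
  have "profile f \<midarrow>0\<rightarrow> 0"
    using cont[of 0] f0 by (simp add: isCont_def profile_def)
  then have "\<forall>\<^sub>F t in at 0. profile f t < m"
    using \<open>m > 0\<close> by (rule order_tendstoD)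
  then obtain \<eta> where \<eta>: "\<eta> > 0" "\<And>t. t \<noteq> 0 \<Longrightarrow> \<bar>t\<bar> < \<eta> \<Longrightarrow> profile f t < m"
    by (auto simp: eventually_at)
  \<comment> \<open>The bound by \<open>\<eta>\<close> makes the profile at \<open>t\<close> smaller
    than \<open>m\<close>, which forces \<open>s < t0\<close>; the bound by \<open>t0\<close> puts
    \<open>t\<close> into the range of monotonicity.\<close>
  define \<epsilon> where "\<epsilon> = min t0 (\<eta> / 2)"
  show thesis
  proof
    show "0 < \<epsilon>" "\<epsilon> < pi" using t0 \<eta> by (auto simp: \<epsilon>_def)
    fix s t assume st: "s \<in> {0..pi}" "t \<in> {0..\<epsilon>}" "profile f s = profile f t"
    have "profile f t < m"
      using \<eta>(2)[of t] st(2) \<open>m > 0\<close> f0 \<eta>(1) by (cases "t = 0") (auto simp: \<epsilon>_def profile_def)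
    then have "s < t0"
      using m[of s] st by force
    then show "s = t"
      using t0(3)[of s t] t0(3)[of t s] st by (force simp: \<epsilon>_def)
  qed
qed

section \<open>Local isometries are linear\<close>

text \<open>Extend \<open>g\<close> linearly from a basis chosen inside \<open>S\<close>. Inner
  products then agree by linearity in each argument, and the squared norm of
  \<open>T x - g x\<close> expands to 0, so \<open>T\<close> agrees with \<open>g\<close> on all of
  \<open>S\<close>.\<close>

lemma inner_preserving_linear_extension:
  fixes g :: "'a::euclidean_space \<Rightarrow> 'b::real_inner"
  assumes g: "\<And>x y. x \<in> S \<Longrightarrow> y \<in> S \<Longrightarrow> g x \<bullet> g y = x \<bullet> y"
  obtains T where "linear T" "\<And>x. x \<in> S \<Longrightarrow> T x = g x"
    "\<And>x y. x \<in> span S \<Longrightarrow> y \<in> span S \<Longrightarrow> T x \<bullet> T y = x \<bullet> y"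
proof -
  obtain B where B: "B \<subseteq> S" "independent B" "S \<subseteq> span B"
    using maximal_independent_subset[of S] by auto
  then obtain T where T: "linear T" "\<And>b. b \<in> B \<Longrightarrow> T b = g b"
    using linear_independent_extend[OF B(2), of g] by blast
  have span: "span S \<subseteq> span B"
    using B(3) by (simp add: span_minimal)
  \<comment> \<open>Here \<open>g y\<close> stands on the right, because \<open>T y = g y\<close> is
    so far known only for \<open>y\<close> in the basis.\<close>
  have 1: "T x \<bullet> g y = x \<bullet> y" if "x \<in> span B" "y \<in> S" for x y
    using that(1)
  proof (induction rule: span_induct_alt)
    case base
    then show ?case by (simp add: linear_0[OF T(1)])
  next
    case (step c x z)
    then show ?case
      using B(1) that(2) by (auto simp: linear_add[OF T(1)] linear_cmul[OF T(1)] T(2) g inner_add_left)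
  qed
  have 2: "T x \<bullet> T y = x \<bullet> y" if "x \<in> span B" "y \<in> span B" for x y
    using that(2)
  proof (induction rule: span_induct_alt)
    case base
    then show ?case by (simp add: linear_0[OF T(1)])
  next
    case (step c y z)
    then show ?case
      using B(1) that(1) by (auto simp: linear_add[OF T(1)] linear_cmul[OF T(1)] T(2) 1 inner_add_right)
  qed
  have "T x = g x" if "x \<in> S" for x
  proof -
    have "x \<in> span B" using B(3) that by auto
    then have "(T x - g x) \<bullet> (T x - g x) = 0"
      using 1[of x x] 2[of x x] that
      by (simp add: inner_diff g inner_commute[of "g x" "T x"])
    then show ?thesis by simp
  qed
  with T 2 span that show thesis by blast
qed

text \<open>The skew part is a \<open>hat\<close>. The symmetric off-diagonal part is polarized: the
  symmetrized product of two basis vectors is the \<open>outer\<close> of their sum minus the two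
  single \<open>outer\<close> matrices, whence the corrections to the diagonal coefficients.\<close>

lemma symmetric_skew_decomposition:
  fixes X :: "real^3^3"
  shows "X = (1 / 2) *\<^sub>R hat (vector [X$3$2 - X$2$3, X$1$3 - X$3$1, X$2$1 - X$1$2]) +
    (X$1$1 - (X$1$2 + X$2$1) / 2 - (X$1$3 + X$3$1) / 2) *\<^sub>R outer (axis 1 1) +
    (X$2$2 - (X$1$2 + X$2$1) / 2 - (X$2$3 + X$3$2) / 2) *\<^sub>R outer (axis 2 1) +
    (X$3$3 - (X$1$3 + X$3$1) / 2 - (X$2$3 + X$3$2) / 2) *\<^sub>R outer (axis 3 1) +
    ((X$1$2 + X$2$1) / 2) *\<^sub>R outer (axis 1 1 + axis 2 1) +
    ((X$1$3 + X$3$1) / 2) *\<^sub>R outer (axis 1 1 + axis 3 1) +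
    ((X$2$3 + X$3$2) / 2) *\<^sub>R outer (axis 2 1 + axis 3 1)"
  by (simp add: vec_eq_iff forall_3 hat_component outer_def axis_def field_simps)

text \<open>Unit vectors suffice since \<open>outer\<close> is homogeneous of degree two and
  \<open>hat\<close> is linear. This serves both to show that small balls span and to prove two
  linear maps equal.\<close>

lemma span_outer_hat:
  assumes V: "subspace V"
    and o: "\<And>v. norm v = 1 \<Longrightarrow> outer v \<in> V" and h: "\<And>v. norm v = 1 \<Longrightarrow> hat v \<in> V"
  shows "V = UNIV"
proof -
  have o': "outer v \<in> V" for v
  proof (cases "v = 0")
    case True
    then have "outer v = 0" by (simp add: outer_def vec_eq_iff)
    then show ?thesis using V by (simp add: subspace_0)
  next
    case False
    have "outer (c *\<^sub>R w) = c\<^sup>2 *\<^sub>R outer w" for c w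
      by (simp add: outer_def vec_eq_iff power2_eq_square)
    then have "outer (norm v *\<^sub>R (v /\<^sub>R norm v)) = (norm v)\<^sup>2 *\<^sub>R outer (v /\<^sub>R norm v)" .
    then have "outer v = (norm v)\<^sup>2 *\<^sub>R outer (v /\<^sub>R norm v)"
      using False by simp
    moreover have "outer (v /\<^sub>R norm v) \<in> V"
      using False by (intro o) simp
    ultimately show ?thesis using V by (simp add: subspace_scale)
  qed
  have h': "hat v \<in> V" for v
  proof (cases "v = 0")
    case True
    then show ?thesis using V by (simp add: linear_0[OF linear_hat] subspace_0)
  next
    case False
    then have "hat v = norm v *\<^sub>R hat (v /\<^sub>R norm v)"
      by (simp add: linear_cmul[OF linear_hat])
    moreover have "hat (v /\<^sub>R norm v) \<in> V"
      using False by (intro h) simp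
    ultimately show ?thesis using V by (metis subspace_scale)
  qed
  have "X \<in> V" for X
    by (subst symmetric_skew_decomposition) (intro subspace_add[OF V] subspace_scale[OF V] o' h')
  then show ?thesis by auto
qed

section \<open>Linear spans of small balls in the rotation group\<close>

lemma rot_sum_difference:
  "rot v t - rot v (- t) = (2 * sin t) *\<^sub>R hat v"
  "rot v t + rot v (- t) = (2 * cos t) *\<^sub>R mat 1 + (2 * (1 - cos t)) *\<^sub>R outer v"
  by (simp_all add: rot_def vec_eq_iff algebra_simps)

lemma dist_mat_1_rot:
  assumes "norm v = 1"
  shows "(dist (mat 1) (rot v t))\<^sup>2 = 4 - 4 * cos t"
  using assms dist_SO3[OF SO3_mat_1 rot_in_SO3[OF assms, of t]]
  by (simp add: inner_commute[of "mat 1"] inner_rot_mat_1)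

text \<open>The rotations about \<open>v\<close> by a small angle \<open>t\<close> and by
  \<open>- t\<close> have a difference proportional to \<open>hat v\<close>, and a sum that yields
  \<open>outer v\<close> after subtracting a multiple of the identity.\<close>

lemma span_SO3_ball_mat_1:
  assumes "\<epsilon> > 0"
  shows "span {R \<in> SO3. dist (mat 1) R < \<epsilon>} = UNIV"
proof (rule span_outer_hat)
  let ?V = "span {R \<in> SO3. dist (mat 1) R < \<epsilon>}"
  have "((\<lambda>t. 4 - 4 * cos t) \<longlongrightarrow> 0) (at (0::real))"
    by (rule tendsto_eq_intros refl | simp)+
  then have "\<forall>\<^sub>F t in at (0::real). 4 - 4 * cos t < \<epsilon>\<^sup>2"
    by (rule order_tendstoD) (use assms in simp)
  then obtain d where d: "d > 0" "\<And>t. t \<noteq> 0 \<Longrightarrow> \<bar>t\<bar> < d \<Longrightarrow> 4 - 4 * cos t < \<epsilon>\<^sup>2"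
    by (auto simp: eventually_at)
  \<comment> \<open>Besides closeness to the identity, \<open>t\<close> must lie in (0, pi), so that
    the divisors \<open>sin t\<close> and \<open>1 - cos t\<close> are nonzero.\<close>
  define t where "t = min (d / 2) 1"
  have t: "0 < t" "t < pi" "t < d"
    using d pi_gt3 by (auto simp: t_def)
  have "sin t > 0" using t by (simp add: sin_gt_zero)
  have "cos t < 1" using t cos_monotone_0_pi[of 0 t] by simp
  have R: "rot v s \<in> ?V" if "norm v = 1" "s = t \<or> s = - t" for v s
  proof -
    have "(dist (mat 1) (rot v s))\<^sup>2 < \<epsilon>\<^sup>2"
      using that d(2)[of t] t by (auto simp: dist_mat_1_rot)
    then have "dist (mat 1) (rot v s) < \<epsilon>"
      using assms by (simp add: power_less_imp_less_base)
    then show ?thesis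
      using that by (auto intro!: span_base simp: rot_in_SO3)
  qed
  have I: "mat 1 \<in> ?V"
    using assms by (intro span_base) (simp add: SO3_mat_1)
  show "hat v \<in> ?V" if "norm v = 1" for v
  proof -
    have "hat v = (1 / (2 * sin t)) *\<^sub>R (rot v t - rot v (- t))"
      using \<open>sin t > 0\<close> by (simp add: rot_sum_difference)
    also have "\<dots> \<in> ?V"
      using that R by (intro span_scale span_diff) auto
    finally show ?thesis .
  qed
  show "outer v \<in> ?V" if "norm v = 1" for v
  proof -
    have "outer v = (1 / (2 * (1 - cos t))) *\<^sub>R (rot v t + rot v (- t) - (2 * cos t) *\<^sub>R mat 1)"
      using \<open>cos t < 1\<close> by (simp add: rot_sum_difference)
    also have "\<dots> \<in> ?V"
      using that R I by (intro span_scale span_diff span_add) auto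
    finally show ?thesis .
  qed
qed simp

lemma dist_SO3_mult_left:
  assumes "A \<in> SO3"
  shows "dist (A ** X) (A ** Y) = dist X (Y :: real^3^3)"
proof -
  have "A ** X - A ** Y = A ** (X - Y)"
    by (simp add: linear_diff[OF linear_matrix_mul_left])
  then show ?thesis
    using assms by (simp add: dist_norm norm_eq_sqrt_inner inner_orthogonal_left SO3_orthogonal)
qed

lemma span_SO3_ball:
  assumes "A \<in> SO3" "\<epsilon> > 0"
  shows "span {B \<in> SO3. dist A B < \<epsilon>} = UNIV"
proof -
  have "(\<lambda>X. A ** X) ` {R \<in> SO3. dist (mat 1) R < \<epsilon>} \<subseteq> {B \<in> SO3. dist A B < \<epsilon>}"
    using assms dist_SO3_mult_left[OF assms(1), of "mat 1"] by (auto simp: SO3_mult)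
  then have "span ((\<lambda>X. A ** X) ` {R \<in> SO3. dist (mat 1) R < \<epsilon>}) \<subseteq> span {B \<in> SO3. dist A B < \<epsilon>}"
    by (rule span_mono)
  moreover have "span ((\<lambda>X. A ** X) ` {R \<in> SO3. dist (mat 1) R < \<epsilon>}) = range (\<lambda>X. A ** X)"
    by (simp add: linear_span_image[OF linear_matrix_mul_left] span_SO3_ball_mat_1 assms)
  moreover have "Y \<in> range (\<lambda>X. A ** X)" for Y
    using SO3_cancel(4)[OF assms(1), of Y] by (metis rangeI)
  ultimately show ?thesis by blast
qed

text \<open>By Euler's theorem the group is a union of one-parameter subgroups, each a continuous
  image of the line passing through the identity.\<close>

lemma connected_SO3: "connected SO3"
proof -
  have "SO3 = (\<Union>v\<in>{v. norm v = 1}. range (rot v))"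
    using rot_in_SO3 by (auto elim!: SO3_euler)
  moreover have "connected (\<Union>v\<in>{v::real^3. norm v = 1}. range (rot v))"
  proof (rule connected_Union)
    have "continuous_on UNIV (rot v)" for v
      unfolding rot_def[abs_def] by (intro continuous_intros)
    then show "connected S" if "S \<in> (\<lambda>v. range (rot v)) ` {v. norm v = 1}" for S
      using that by (auto intro!: connected_continuous_image)
    have "mat 1 = rot v 0" for v by (simp add: rot_def)
    then have "mat 1 \<in> \<Inter> ((\<lambda>v. range (rot v)) ` {v. norm v = 1})"
      by auto
    then show "\<Inter> ((\<lambda>v. range (rot v)) ` {v. norm v = 1}) \<noteq> {}" by blast
  qed
  ultimately show ?thesis by simp
qed

lemma locally_isometric_imp_linear:
  assumes "\<delta> > 0"
    and \<phi>: "\<And>A B. A \<in> SO3 \<Longrightarrow> B \<in> SO3 \<Longrightarrow> dist A B < \<delta> \<Longrightarrow> \<phi> A \<bullet> \<phi> B = A \<bullet> B"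
  obtains T :: "real^3^3 \<Rightarrow> real^3^3" where "linear T" "\<And>A. A \<in> SO3 \<Longrightarrow> T A = \<phi> A"
    "\<And>X Y. T X \<bullet> T Y = X \<bullet> Y"
proof -
  \<comment> \<open>Any two points of a ball of half the radius are at distance less than
    \<open>\<delta>\<close>.\<close>
  define \<epsilon> where "\<epsilon> = \<delta> / 2"
  have "\<epsilon> > 0" using \<open>\<delta> > 0\<close> by (simp add: \<epsilon>_def)
  define ok where "ok A T \<longleftrightarrow> linear T \<and> (\<forall>B\<in>SO3. dist A B < \<epsilon> \<longrightarrow> T B = \<phi> B) \<and> (\<forall>X Y. T X \<bullet> T Y = X \<bullet> Y)"
    for A and T :: "real^3^3 \<Rightarrow> real^3^3"
  have "\<exists>T. ok A T" if "A \<in> SO3" for A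
  proof -
    let ?S = "{B \<in> SO3. dist A B < \<epsilon>}"
    have pres: "\<phi> B \<bullet> \<phi> C = B \<bullet> C" if "B \<in> ?S" "C \<in> ?S" for B C
    proof (rule \<phi>)
      show "dist B C < \<delta>"
        using that dist_triangle3[of B C A] by (simp add: \<epsilon>_def)
    qed (use that in auto)
    obtain T where "linear T" "\<And>B. B \<in> ?S \<Longrightarrow> T B = \<phi> B"
      "\<And>X Y. X \<in> span ?S \<Longrightarrow> Y \<in> span ?S \<Longrightarrow> T X \<bullet> T Y = X \<bullet> Y"
      using inner_preserving_linear_extension[of ?S \<phi>, OF pres] by blast
    then have "ok A T"
      unfolding ok_def span_SO3_ball[OF that \<open>\<epsilon> > 0\<close>] by simp
    then show ?thesis by blast
  qed
  then obtain T where T: "\<And>A. A \<in> SO3 \<Longrightarrow> ok A (T A)"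
    by metis
  \<comment> \<open>The ball of radius \<open>\<epsilon> / 2\<close> about \<open>A\<close> lies in
    both balls of radius \<open>\<epsilon>\<close>, so both maps agree there with
    \<open>\<phi>\<close>, and it still spans the whole space.\<close>
  have eq: "T A = T A'" if A: "A \<in> SO3" "A' \<in> SO3" "dist A A' < \<epsilon> / 2" for A A'
  proof
    fix X
    have "linear (T A)" "linear (T A')"
      using T A by (auto simp: ok_def)
    then show "T A X = T A' X"
    proof (rule linear_eq_on_span[where B = "{B \<in> SO3. dist A B < \<epsilon> / 2}"])
      show "X \<in> span {B \<in> SO3. dist A B < \<epsilon> / 2}"
        by (subst span_SO3_ball) (use A(1) \<open>\<epsilon> > 0\<close> in simp_all)
      show "T A B = T A' B" if "B \<in> {B \<in> SO3. dist A B < \<epsilon> / 2}" for B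
      proof -
        have "dist A B < \<epsilon>" "dist A' B < \<epsilon>"
          using that A(3) \<open>\<epsilon> > 0\<close> dist_triangle3[of A' B A] by (simp_all add: dist_commute)
        then have "T A B = \<phi> B" "T A' B = \<phi> B"
          using T[OF A(1)] T[OF A(2)] that by (simp_all add: ok_def)
        then show ?thesis by simp
      qed
    qed
  qed
  \<comment> \<open>The choice of linear map is locally constant on a connected set; no continuity
    of \<open>\<phi>\<close> enters.\<close>
  have "T A = T (mat 1)" if "A \<in> SO3" for A
  proof (rule connected_local_const[OF connected_SO3 that SO3_mat_1], intro ballI)
    fix A assume "A \<in> SO3"
    then have "\<forall>B\<in>SO3. B \<noteq> A \<and> dist B A < \<epsilon> / 2 \<longrightarrow> T A = T B"
      by (metis eq dist_commute)
    then show "\<forall>\<^sub>F B in at A within SO3. T A = T B"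
      using half_gt_zero[OF \<open>\<epsilon> > 0\<close>] unfolding eventually_at by blast
  qed
  then have "T (mat 1) A = \<phi> A" if "A \<in> SO3" for A
    using T[OF that] that \<open>\<epsilon> > 0\<close> unfolding ok_def by (metis dist_self)
  moreover have "linear (T (mat 1))" "\<And>X Y. T (mat 1) X \<bullet> T (mat 1) Y = X \<bullet> Y"
    using T[OF SO3_mat_1] by (simp_all add: ok_def)
  ultimately show thesis
    using that by blast
qed

section \<open>Linear isometries preserving rotations\<close>

text \<open>The two possible signs of the sine are absorbed by reversing the axis, which changes
  \<open>hat\<close> but not \<open>outer\<close>.\<close>

lemma obtain_quarter_turn:
  assumes "A \<in> SO3" "A \<bullet> mat 1 = 1"
  obtains u where "norm u = 1" "A = outer u + hat u"
proof -
  obtain v \<theta> where v: "norm v = 1" "A = rot v \<theta>"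
    using assms(1) by (rule SO3_euler)
  then have c: "cos \<theta> = 0" using assms(2) by (simp add: inner_rot_mat_1)
  then have "sin \<theta> = 1 \<or> sin \<theta> = - 1"
    using sin_cos_squared_add[of \<theta>] by (simp add: power2_eq_1_iff)
  then have "A = outer v + hat v \<or> A = outer (- v) + hat (- v)"
    using c v by (auto simp: rot_def outer_uminus hat_uminus)
  then show thesis using that[of v] that[of "- v"] v(1) by auto
qed

lemma obtain_half_turn:
  assumes "A \<in> SO3" "A \<bullet> mat 1 = - 1"
  obtains u where "A = 2 *\<^sub>R outer u - mat 1"
proof -
  obtain v \<theta> where v: "norm v = 1" "A = rot v \<theta>"
    using assms(1) by (rule SO3_euler)
  then have c: "cos \<theta> = - 1" using assms(2) by (simp add: inner_rot_mat_1)
  then have "sin \<theta> = 0"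
    using sin_cos_squared_add[of \<theta>] by simp
  then have "A = 2 *\<^sub>R outer v - mat 1"
    using c v by (simp add: rot_def)
  then show thesis by (rule that)
qed

lemma rot_quarter_half:
  "rot v (pi / 2) = outer v + hat v" "rot v (- (pi / 2)) = outer v - hat v"
  "rot v pi = 2 *\<^sub>R outer v - mat 1"
  by (simp_all add: rot_def)

text \<open>The half turn about \<open>v\<close> shows that \<open>T (outer v)\<close> is symmetric.
  The two opposite quarter turns then identify it, together with \<open>T (hat v)\<close>, by
  comparing symmetric and skew parts.\<close>

lemma isometry_outer_hat:
  assumes T: "linear T" and iso: "\<And>X Y. T X \<bullet> T Y = X \<bullet> Y"
    and T1: "T (mat 1) = mat 1" and S: "\<And>A. A \<in> SO3 \<Longrightarrow> T A \<in> SO3" and v: "norm v = 1"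
  obtains u where "norm u = 1" "T (outer v) = outer u" "T (hat v) = hat u"
proof -
  have tr: "T X \<bullet> mat 1 = X \<bullet> mat 1" for X
    using iso[of X "mat 1"] T1 by simp
  have R: "T (rot v t) \<in> SO3" "T (rot v t) \<bullet> mat 1 = 1 + 2 * cos t" for t
    using v by (simp_all add: S rot_in_SO3 tr inner_rot_mat_1)
  obtain w where "T (rot v pi) = 2 *\<^sub>R outer w - mat 1"
    using R[of pi] by (auto intro: obtain_half_turn)
  then have "2 *\<^sub>R T (outer v) = 2 *\<^sub>R outer w"
    by (simp add: rot_quarter_half linear_diff[OF T] linear_cmul[OF T] T1)
  then have w: "T (outer v) = outer w" by simp
  obtain u where u: "norm u = 1" "T (outer v) + T (hat v) = outer u + hat u"
    using R[of "pi / 2"] by (auto intro: obtain_quarter_turn simp: rot_quarter_half linear_add[OF T])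
  obtain u' where u': "T (outer v) - T (hat v) = outer u' + hat u'"
    using R[of "- (pi / 2)"] by (auto intro: obtain_quarter_turn simp: rot_quarter_half linear_diff[OF T])
  have "2 *\<^sub>R outer w = (outer u + hat u) + (outer u' + hat u')"
    by (simp add: scaleR_2 flip: u(2) u' w)
  \<comment> \<open>The left side is symmetric and the right side is skew, so both vanish; this
    gives \<open>u' = - u\<close>.\<close>
  then have e: "2 *\<^sub>R outer w - outer u - outer u' = hat (u + u')"
    by (simp add: linear_add[OF linear_hat] algebra_simps)
  then have "transpose (hat (u + u')) = hat (u + u')"
    by (simp add: linear_diff[OF linear_transpose] linear_cmul[OF linear_transpose] transpose_outer flip: e)
  then have "hat (u + u') = 0"
    by (simp add: transpose_hat vec_eq_iff)
  then have "hat (u + u') = hat 0" by (simp add: linear_0[OF linear_hat])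
  then have "u' = - u" by (simp add: hat_inject eq_neg_iff_add_eq_0 add.commute)
  then have "2 *\<^sub>R outer w = 2 *\<^sub>R outer u"
    using e \<open>hat (u + u') = 0\<close> by (simp add: outer_uminus scaleR_2)
  then have "T (outer v) = outer u" using w by simp
  moreover from this have "T (hat v) = hat u" using u(2) by simp
  ultimately show thesis using u(1) that by blast
qed

text \<open>On skew matrices \<open>T\<close> induces an orthogonal map \<open>L\<close> of
  three-space through \<open>hat\<close>. Its matrix \<open>Q\<close> also describes
  \<open>T\<close> on the \<open>outer\<close> matrices, and the two families together span.\<close>

lemma SO3_linear_isometry_classification:
  assumes T: "linear T" and iso: "\<And>X Y. T X \<bullet> T Y = X \<bullet> Y"
    and T1: "T (mat 1) = mat 1" and S: "\<And>A. A \<in> SO3 \<Longrightarrow> T A \<in> SO3"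
  obtains Q where "Q \<in> O3"
    "(\<forall>X. T X = Q ** X ** transpose Q) \<or> (\<forall>X. T X = Q ** transpose X ** transpose Q)"
proof -
  have unit: "\<exists>u. T (outer v) = outer u \<and> T (hat v) = hat u" if "norm v = 1" for v
    by (rule isometry_outer_hat[OF T _ T1 _ that]) (use iso S in auto)
  have "\<exists>u. T (hat v) = hat u" for v
  proof (cases "v = 0")
    case True
    then show ?thesis using linear_0[OF T] linear_0[OF linear_hat] by metis
  next
    case False
    then have "norm (v /\<^sub>R norm v) = 1" by simp
    then obtain u where "T (hat (v /\<^sub>R norm v)) = hat u"
      using unit by blast
    then have "T (hat (norm v *\<^sub>R (v /\<^sub>R norm v))) = hat (norm v *\<^sub>R u)"
      unfolding linear_cmul[OF linear_hat] linear_cmul[OF T] by simp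
    then show ?thesis using False by auto
  qed
  then obtain L where L: "\<And>v. T (hat v) = hat (L v)" by metis
  have "L (v + w) = L v + L w" for v w
  proof -
    have "hat (L (v + w)) = hat (L v + L w)"
      by (simp add: linear_add[OF linear_hat] linear_add[OF T] flip: L)
    then show ?thesis by (simp add: hat_inject)
  qed
  moreover have "L (c *\<^sub>R v) = c *\<^sub>R L v" for c v
  proof -
    have "hat (L (c *\<^sub>R v)) = hat (c *\<^sub>R L v)"
      by (simp add: linear_cmul[OF linear_hat] linear_cmul[OF T] flip: L)
    then show ?thesis by (simp add: hat_inject)
  qed
  ultimately have linL: "linear L" by (rule linearI)
  have "L v \<bullet> L w = v \<bullet> w" for v w
    using iso[of "hat v" "hat w"] by (simp add: L inner_hat)
  with linL have "orthogonal_transformation L"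
    by (simp add: orthogonal_transformation_def)
  then have "orthogonal_matrix (matrix L)"
    by (simp add: orthogonal_transformation_matrix)
  moreover define Q where "Q = matrix L"
  ultimately have Q: "orthogonal_matrix Q" by simp
  have QL: "Q *v v = L v" for v
    using linL by (simp add: Q_def matrix_works linear_matrix_vector_mul_eq)
  \<comment> \<open>One vector \<open>u\<close> serves both \<open>outer\<close> and
    \<open>hat\<close>, and injectivity of \<open>hat\<close> identifies it with
    \<open>L v\<close>.\<close>
  have outer: "T (outer v) = outer (L v)" if "norm v = 1" for v
  proof -
    obtain u where "T (outer v) = outer u" "T (hat v) = hat u"
      using unit[OF \<open>norm v = 1\<close>] by blast
    then show ?thesis by (simp add: L hat_inject)
  qed
  have eqI: "T = F" if F: "linear F" and "\<And>v. F (outer v) = outer (L v)" "\<And>v. F (hat v) = hat (L v)" for F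
  proof -
    have "{X. T X = F X} = UNIV"
      by (rule span_outer_hat) (use that outer L in
        \<open>auto simp: subspace_def linear_0[OF T] linear_0[OF F] linear_add[OF T] linear_add[OF F]
           linear_cmul[OF T] linear_cmul[OF F]\<close>)
    then show ?thesis by blast
  qed
  have "det Q = 1 \<or> det Q = - 1" using Q by (rule det_orthogonal_matrix)
  then have "T = (\<lambda>X. Q ** X ** transpose Q) \<or> T = (\<lambda>X. Q ** transpose X ** transpose Q)"
  proof (elim disjE)
    assume "det Q = 1"
    then show ?thesis
      by (intro disjI1 eqI linear_matrix_conj) (simp_all add: outer_conj hat_conj[OF Q] QL)
  next
    \<comment> \<open>Now conjugation by \<open>Q\<close> takes \<open>hat v\<close> to the negative
      of \<open>hat (L v)\<close>. Transposing first corrects this sign and leaves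
      \<open>outer v\<close> unchanged.\<close>
    assume d: "det Q = - 1"
    have "linear (\<lambda>X. Q ** transpose X ** transpose Q)"
      using linear_compose[OF linear_transpose linear_matrix_conj] by (simp add: o_def)
    moreover have "Q ** - hat v ** transpose Q = - (Q ** hat v ** transpose Q)" for v
      by (rule linear_neg[OF linear_matrix_conj])
    ultimately show ?thesis using d
      by (intro disjI2 eqI) (simp_all add: outer_conj hat_conj[OF Q] QL transpose_outer transpose_hat)
  qed
  moreover have "Q \<in> O3" using Q by (simp add: O3_def)
  ultimately show thesis using that by metis
qed

section \<open>The two directions of the classification\<close>

lemma conj_form_preserves_inner:
  assumes P: "P \<in> SO3" and Q: "orthogonal_matrix Q"
  shows "(P ** Q ** A ** transpose Q) \<bullet> (P ** Q ** B ** transpose Q) = A \<bullet> B"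
proof -
  have "orthogonal_matrix (P ** Q)"
    using P Q by (simp add: orthogonal_matrix_mul SO3_orthogonal)
  then show ?thesis
    using Q by (simp add: inner_orthogonal_left inner_orthogonal_right)
qed

lemma SO3_local_isometry_classification:
  assumes "\<delta> > 0" and \<phi>: "\<phi> \<in> SO3 \<rightarrow> SO3"
    and iso: "\<And>A B. A \<in> SO3 \<Longrightarrow> B \<in> SO3 \<Longrightarrow> dist A B < \<delta> \<Longrightarrow> \<phi> A \<bullet> \<phi> B = A \<bullet> B"
  obtains Q where "Q \<in> O3"
    "(\<forall>A\<in>SO3. \<phi> A = \<phi> (mat 1) ** Q ** A ** transpose Q) \<or>
     (\<forall>A\<in>SO3. \<phi> A = \<phi> (mat 1) ** Q ** transpose A ** transpose Q)"
proof -
  obtain T where T: "linear T" "\<And>A. A \<in> SO3 \<Longrightarrow> T A = \<phi> A" "\<And>X Y. T X \<bullet> T Y = X \<bullet> Y"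
    using locally_isometric_imp_linear[OF assms(1) iso] by blast
  define P where "P = \<phi> (mat 1)"
  have P: "P \<in> SO3" using \<phi> SO3_mat_1 by (auto simp: P_def)
  \<comment> \<open>Left translation by the inverse of \<open>\<phi> (mat 1)\<close> normalizes the
    linear map to fix the identity.\<close>
  define T' where "T' X = transpose P ** T X" for X
  have "linear T'"
    using linear_compose[OF T(1) linear_matrix_mul_left] by (simp add: T'_def[abs_def] o_def)
  moreover have "T' X \<bullet> T' Y = X \<bullet> Y" for X Y
    using P T(3) by (simp add: T'_def inner_orthogonal_left SO3_orthogonal)
  moreover have "T' (mat 1) = mat 1"
    using P T(2)[OF SO3_mat_1] by (simp add: T'_def SO3_cancel flip: P_def)
  moreover have "T' A \<in> SO3" if "A \<in> SO3" for A
    using that \<phi> P T(2) by (auto simp: T'_def intro!: SO3_mult SO3_transpose)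
  ultimately obtain Q where Q: "Q \<in> O3"
    "(\<forall>X. T' X = Q ** X ** transpose Q) \<or> (\<forall>X. T' X = Q ** transpose X ** transpose Q)"
    by (rule SO3_linear_isometry_classification)
  have "\<phi> A = P ** T' A" if "A \<in> SO3" for A
    using that P T(2) by (simp add: T'_def SO3_cancel)
  then show thesis
    using that[OF Q(1)] Q(2) by (auto simp: P_def matrix_mul_assoc)
qed

theorem theorem2p2:
  fixes N :: "complex^3^3 \<Rightarrow> real"
    and f :: "complex \<Rightarrow> complex"
    and \<phi> :: "real^3^3 \<Rightarrow> real^3^3"
  assumes N: "\<exists>c>0. \<forall>M. N M = c * frobenius_norm M"
    and bdd: "bounded (f ` sphere 0 1)"
    and f1: "\<forall>z\<in>sphere 0 1. f z = 0 \<longleftrightarrow> z = 1"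
    and f2: "conformal_near_1 f"
    and f3: "continuous_on (sphere 0 1 - {-1}) f"
    and f4: "((\<lambda>t. f (exp (\<i> * complex_of_real t))) \<longlongrightarrow> f (-1)) (at_left pi)"
    and f5: "\<exists>L. L \<noteq> 0 \<and> ((\<lambda>t. f (exp (\<i> * complex_of_real t))) \<longlongrightarrow> L) (at_right (-pi))"
    and \<phi>: "\<phi> \<in> SO3 \<rightarrow> SO3"
  shows "(\<forall>A\<in>SO3. \<forall>B\<in>SO3. dist_Nf N f (\<phi> A) (\<phi> B) = dist_Nf N f A B) \<longleftrightarrow>
    (\<exists>Q\<in>O3.
      (\<forall>A\<in>SO3. \<phi> A = \<phi> (mat 1) ** Q ** A ** matrix_inv Q) \<or>
      (\<forall>A\<in>SO3. \<phi> A = \<phi> (mat 1) ** Q ** matrix_inv A ** matrix_inv Q))"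
proof -
  have f0: "f 1 = 0" using f1 by simp
  obtain c where c: "c > 0" "\<And>M. N M = c * frobenius_norm M" using N by auto
  have dist: "dist_Nf N f A B = c * sqrt (profile f (SO3_angle A B))" if "A \<in> SO3" "B \<in> SO3" for A B
    using dist_Nf_eq_profile[of N c f A B] c(2) f0 that by simp
  have \<phi>S: "\<phi> A \<in> SO3" if "A \<in> SO3" for A using \<phi> that by auto
  have inv: "matrix_inv A = transpose A" if "A \<in> O3 \<or> A \<in> SO3" for A
    using that by (auto simp: O3_def SO3_def intro: matrix_inv_orthogonal)
  have form_iff: "(\<exists>Q\<in>O3. (\<forall>A\<in>SO3. \<phi> A = \<phi> (mat 1) ** Q ** A ** matrix_inv Q) \<or>
      (\<forall>A\<in>SO3. \<phi> A = \<phi> (mat 1) ** Q ** matrix_inv A ** matrix_inv Q)) \<longleftrightarrow>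
    (\<exists>Q\<in>O3. (\<forall>A\<in>SO3. \<phi> A = \<phi> (mat 1) ** Q ** A ** transpose Q) \<or>
      (\<forall>A\<in>SO3. \<phi> A = \<phi> (mat 1) ** Q ** transpose A ** transpose Q))"
    by (simp add: inv cong: bex_cong_simp ball_cong_simp)
  show ?thesis
    unfolding form_iff
  proof
    assume R: "\<forall>A\<in>SO3. \<forall>B\<in>SO3. dist_Nf N f (\<phi> A) (\<phi> B) = dist_Nf N f A B"
    obtain L where L: "L \<noteq> 0" "((\<lambda>t. f (exp (\<i> * complex_of_real t))) \<longlongrightarrow> L) (at_right (-pi))"
      using f5 by blast
    obtain \<epsilon> where \<epsilon>: "0 < \<epsilon>" "\<epsilon> < pi"
      "\<And>s t. s \<in> {0..pi} \<Longrightarrow> t \<in> {0..\<epsilon>} \<Longrightarrow> profile f s = profile f t \<Longrightarrow> s = t"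
      using profile_locally_rigid[of f L, OF f1 f2 f3 f4 L] by blast
    \<comment> \<open>The distance between two rotations whose relative angle is
      \<open>\<epsilon>\<close>.\<close>
    define \<delta> where "\<delta> = sqrt (4 - 4 * cos \<epsilon>)"
    have "cos \<epsilon> < 1" using \<epsilon> cos_monotone_0_pi[of 0 \<epsilon>] by simp
    then have "\<delta> > 0" by (simp add: \<delta>_def)
    have iso: "\<phi> A \<bullet> \<phi> B = A \<bullet> B" if A: "A \<in> SO3" and B: "B \<in> SO3" and d: "dist A B < \<delta>" for A B
    proof -
      have "(dist A B)\<^sup>2 < \<delta>\<^sup>2"
        using d by (intro power_strict_mono) auto
      then have "cos \<epsilon> < cos (SO3_angle A B)"
        using \<open>cos \<epsilon> < 1\<close> by (simp add: dist_SO3 A B inner_eq_cos_angle \<delta>_def)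
      then have "SO3_angle A B < \<epsilon>"
        using cos_mono_less_eq[of \<epsilon> "SO3_angle A B"] SO3_angle_bounds[OF A B] \<epsilon>(1,2) by simp
      moreover have "profile f (SO3_angle (\<phi> A) (\<phi> B)) = profile f (SO3_angle A B)"
        using R[rule_format, OF A B] c(1) by (simp add: dist A B \<phi>S)
      \<comment> \<open>Only the angle of \<open>A\<close> and \<open>B\<close> is known to be
        small; rigidity allows the angle of the images to be anywhere in [0, pi].\<close>
      ultimately have "SO3_angle (\<phi> A) (\<phi> B) = SO3_angle A B"
        using \<epsilon>(3)[of "SO3_angle (\<phi> A) (\<phi> B)" "SO3_angle A B"] SO3_angle_bounds[OF A B]
          SO3_angle_bounds[OF \<phi>S[OF A] \<phi>S[OF B]] by simp
      then show ?thesis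
        using inner_eq_cos_angle[OF A B] inner_eq_cos_angle[OF \<phi>S[OF A] \<phi>S[OF B]] by simp
    qed
    obtain Q where "Q \<in> O3"
      "(\<forall>A\<in>SO3. \<phi> A = \<phi> (mat 1) ** Q ** A ** transpose Q) \<or>
       (\<forall>A\<in>SO3. \<phi> A = \<phi> (mat 1) ** Q ** transpose A ** transpose Q)"
      using SO3_local_isometry_classification[of \<delta> \<phi>, OF \<open>\<delta> > 0\<close> \<phi> iso] by blast
    then show "\<exists>Q\<in>O3. (\<forall>A\<in>SO3. \<phi> A = \<phi> (mat 1) ** Q ** A ** transpose Q) \<or>
      (\<forall>A\<in>SO3. \<phi> A = \<phi> (mat 1) ** Q ** transpose A ** transpose Q)"
      by blast
  next
    assume "\<exists>Q\<in>O3. (\<forall>A\<in>SO3. \<phi> A = \<phi> (mat 1) ** Q ** A ** transpose Q) \<or>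
      (\<forall>A\<in>SO3. \<phi> A = \<phi> (mat 1) ** Q ** transpose A ** transpose Q)"
    then obtain Q where Q: "Q \<in> O3" and
      form: "(\<forall>A\<in>SO3. \<phi> A = \<phi> (mat 1) ** Q ** A ** transpose Q) \<or>
        (\<forall>A\<in>SO3. \<phi> A = \<phi> (mat 1) ** Q ** transpose A ** transpose Q)"
      by blast
    \<comment> \<open>Both forms preserve all inner products, inversion being transposition on
      rotations, and the distance depends only on the inner product.\<close>
    have "\<phi> A \<bullet> \<phi> B = A \<bullet> B" if A: "A \<in> SO3" and B: "B \<in> SO3" for A B
    proof -
      have *: "(\<phi> (mat 1) ** Q ** X ** transpose Q) \<bullet> (\<phi> (mat 1) ** Q ** Y ** transpose Q) = X \<bullet> Y" for X Y
        using Q by (intro conj_form_preserves_inner \<phi>S SO3_mat_1) (simp add: O3_def)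
      show ?thesis
        using form
      proof
        assume "\<forall>A\<in>SO3. \<phi> A = \<phi> (mat 1) ** Q ** A ** transpose Q"
        then show ?thesis using A B *[of A B] by simp
      next
        assume "\<forall>A\<in>SO3. \<phi> A = \<phi> (mat 1) ** Q ** transpose A ** transpose Q"
        then show ?thesis using A B *[of "transpose A" "transpose B"] by (simp add: inner_transpose)
      qed
    qed
    then show "\<forall>A\<in>SO3. \<forall>B\<in>SO3. dist_Nf N f (\<phi> A) (\<phi> B) = dist_Nf N f A B"
      by (simp add: dist \<phi>S SO3_angle_def)
  qed
qed

end
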